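(* Let $r\ge 2$ be an integer, let $c>0$ and $\alpha>0$ be constants, and for each number of users $n$ let $m=m(n)=\lfloor c\,n^{\frac{2}{r-1}-\alpha}\rfloor$ be the number of observations per user. Let $\mathbf{p}_1\in(0,1)^r$ be a fixed probability vector, and let $\mathbf{p}_2,\mathbf{p}_3,\dots$ be random probability vectors on $\{0,\dots,r-1\}$, independent of each other, such that the vector of the first $r-1$ coordinates $(p_u(0),\dots,p_u(r-2))$ of each $\mathbf{p}_u$ ($u\ge2$) has a continuous density $f_{\mathbf{P}}$ for which there exist constants $\delta_1,\delta_2>0$ with $\delta_1<f_{\mathbf{P}}<\delta_2$ on $R_{\mathbf{P}}$ and $f_{\mathbf{P}}=0$ outside $R_{\mathbf{P}}$, where $$R_{\mathbf{P}}=\{(x_1,\dots,x_{r-1})\in(0,1)^{r-1}:\ x_i>0,\ x_1+\cdots+x_{r-1}<1\}.$$ Suppose $\mathbf{P}=(\mathbf{p}_1,\dots,\mathbf{p}_n)$ is known to the adversary. Let $X_u(t)$ and $\mathbf{Y}^{(m)}$ be the $r$-state user locations and the anonymized observations defined in the context. Then user $1$ has perfect location privacy at every time, i.e. $$\forall k\in\mathbb{N},\qquad \lim_{n\to\infty} I\big(X_1(k);\mathbf{Y}^{(m)}\,\big|\,\mathbf{P}\big)=0 .$$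
   Context: $r$-state i.i.d. model. There are users $u=1,2,3,\dots$ and $r$ locations $0,1,\dots,r-1$. $X_u(t)\in\{0,\dots,r-1\}$ is the location of user $u$ at time $t\in\mathbb{N}=\{1,2,\dots\}$. Write $\mathbf{p}_u=(p_u(0),\dots,p_u(r-1))$, a probability vector (entries sum to $1$). Conditionally on $(\mathbf{p}_u)_{u\ge1}$, all the variables $X_u(t)$ ($u\ge1,\ t\ge1$) are mutually independent and $P(X_u(t)=i)=p_u(i)$. Anonymization. For each $n$, $\Pi=\Pi^{(n)}$ is a uniformly random permutation of $\{1,\dots,n\}$, independent of the $\mathbf{p}_u$'s and of all $X_u(t)$. Put $\mathbf{X}_u^{(m)}=(X_u(1),\dots,X_u(m))^T$. The adversary observes the $m\times n$ matrix $$\mathbf{Y}^{(m)}=\big(\mathbf{X}^{(m)}_{\Pi^{-1}(1)},\mathbf{X}^{(m)}_{\Pi^{-1}(2)},\dots,\mathbf{X}^{(m)}_{\Pi^{-1}(n)}\big),$$ so that the $\Pi(u)$-th column of $\mathbf{Y}^{(m)}$ is $\mathbf{X}_u^{(m)}$ (if $m=0$ there are no observations). $I(X;Y\mid \mathbf{P})=H(X\mid \mathbf{P})-H(X\mid Y,\mathbf{P})$ is conditional mutual information (averaged over $\mathbf{P}$); conditioning on $\mathbf{P}=(\mathbf{p}_1,\dots,\mathbf{p}_n)$ expresses that the adversary knows $\mathbf{P}$. *)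

theory Defs
  imports "HOL-Probability.Probability"
begin

definition prob_vector :: "nat \<Rightarrow> (nat \<Rightarrow> real) \<Rightarrow> bool" where
  "prob_vector r q \<longleftrightarrow> (\<forall>i<r. 0 \<le> q i) \<and> (\<Sum>i<r. q i) = 1"

definition vec_space :: "nat \<Rightarrow> (nat \<Rightarrow> real) measure" where
  "vec_space r = PiM {..<r} (\<lambda>_. borel)"

text \<open>
  Points of \<open>\<real>\<close>-space of dimension \<open>r - 1\<close> are the functions in
  \<open>extensional {..<r - 1}\<close>.  On this set the product topology of \<open>nat \<Rightarrow> real\<close> is the
  Euclidean one.  The index is shifted: coordinate \<open>i\<close> is the variable usually called
  \<open>x\<close> with index \<open>i + 1\<close>.
\<close>

definition param_region :: "nat \<Rightarrow> (nat \<Rightarrow> real) set" where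
  "param_region r = {x \<in> {..<r - 1} \<rightarrow>\<^sub>E {0<..<1}. (\<Sum>i<r - 1. x i) < 1}"

text \<open>The sigma-algebra generated by all of \<open>p 1, p 2, \<dots>\<close>.\<close>

definition params_sigma :: "'a measure \<Rightarrow> nat \<Rightarrow> (nat \<Rightarrow> 'a \<Rightarrow> nat \<Rightarrow> real) \<Rightarrow> 'a measure" where
  "params_sigma M r p =
     vimage_algebra (space M) (\<lambda>\<omega>. \<lambda>u\<in>{1..}. p u \<omega>) (PiM {1..} (\<lambda>_. vec_space r))"

text \<open>The sigma-algebra generated by all of the \<open>p u\<close> and \<open>X u t\<close> together.\<close>

definition params_locations_sigma ::
    "'a measure \<Rightarrow> nat \<Rightarrow> (nat \<Rightarrow> 'a \<Rightarrow> nat \<Rightarrow> real) \<Rightarrow> (nat \<Rightarrow> nat \<Rightarrow> 'a \<Rightarrow> nat) \<Rightarrow> 'a measure" where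
  "params_locations_sigma M r p X =
     vimage_algebra (space M)
       (\<lambda>\<omega>. (\<lambda>u\<in>{1..}. p u \<omega>, \<lambda>(u, t)\<in>{1..} \<times> {1..}. X u t \<omega>))
       (PiM {1..} (\<lambda>_. vec_space r) \<Otimes>\<^sub>M PiM ({1..} \<times> {1..}) (\<lambda>_. count_space {..<r}))"

definition cond_prob_sigma :: "'a measure \<Rightarrow> 'a measure \<Rightarrow> 'a set \<Rightarrow> 'a \<Rightarrow> real" where
  "cond_prob_sigma M F A = real_cond_exp M F (indicator A)"

text \<open>
  Mutual conditional independence given \<open>F\<close> of a family of variables with countable range,
  for which it suffices to test the events that fix the values of finitely many members.
\<close>

definition cond_indep_discrete ::
    "'a measure \<Rightarrow> 'a measure \<Rightarrow> ('i \<Rightarrow> 'a \<Rightarrow> 'b::countable) \<Rightarrow> 'i set \<Rightarrow> bool" where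
  "cond_indep_discrete M F V I \<longleftrightarrow>
     (\<forall>J x. J \<subseteq> I \<longrightarrow> finite J \<longrightarrow>
        (AE \<omega> in M. cond_prob_sigma M F {\<omega> \<in> space M. \<forall>j\<in>J. V j \<omega> = x j} \<omega> =
           (\<Prod>j\<in>J. cond_prob_sigma M F {\<omega> \<in> space M. V j \<omega> = x j} \<omega>)))"

definition permutations_upto :: "nat \<Rightarrow> (nat \<Rightarrow> nat) set" where
  "permutations_upto n = {\<pi>. \<pi> permutes {1..n}}"

text \<open>
  An \<open>m \<times> n\<close> matrix over the set of locations is a function of the index pair (row \<open>t\<close>, column \<open>v\<close>).
  Column \<open>\<pi> u\<close> of the observation matrix is the trace of user \<open>u\<close>.
\<close>

definition obs_matrix ::
    "(nat \<Rightarrow> nat \<Rightarrow> 'a \<Rightarrow> nat) \<Rightarrow> (nat \<Rightarrow> nat) \<Rightarrow> nat \<Rightarrow> nat \<Rightarrow> 'a \<Rightarrow> nat \<times> nat \<Rightarrow> nat" where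
  "obs_matrix X \<pi> m n \<omega> = (\<lambda>(t, v)\<in>{1..m} \<times> {1..n}. X (inv \<pi> v) t \<omega>)"

definition matrix_space :: "nat \<Rightarrow> nat \<Rightarrow> nat \<Rightarrow> (nat \<times> nat \<Rightarrow> nat) measure" where
  "matrix_space r m n = count_space ({1..m} \<times> {1..n} \<rightarrow>\<^sub>E {..<r})"

end

theory Submission
  imports Defs "HOL-Real_Asymp.Real_Asymp"
begin

text \<open>
  Let \<open>g\<close> be the posterior probability of \<open>X 1 k = i\<close> given the observations and the parameters, and
  let \<open>G = g - q i\<close>.  The conditional mutual information is at most the expected \<open>\<chi>\<^sup>2\<close>-divergence of the
  posterior from \<open>q\<close>, so it suffices that \<open>E (G\<^sup>2)\<close> vanishes.  Now \<open>E (G\<^sup>2) = E (Z 1 * G)\<close> with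
  \<open>Z u\<close> the indicator of \<open>X u k = i\<close> minus \<open>q i\<close>.  Because the permutation is uniform, exchanging
  user 1 with another user \<open>u\<close> does not change the observations; if \<open>p u\<close> is within \<open>\<epsilon>\<close> of \<open>q\<close>, it
  changes the law of the traces by \<open>O(\<epsilon> * sqrt m)\<close> in total variation.  Hence \<open>Z 1\<close> may be replaced
  by the average of \<open>Z u\<close> over all \<open>N\<close> such users, whose mean absolute value is at most
  \<open>1 / sqrt N + \<epsilon>\<close>.  With \<open>\<epsilon>\<close> slightly larger than \<open>n\<close> to the power \<open>- 1 / (r - 1)\<close>, the product
  \<open>\<epsilon> * sqrt m\<close> still vanishes while \<open>N\<close> tends to infinity in probability.
\<close>

section \<open>Product distributions on finite sets\<close>

text \<open>The exponent 2 / (r - 1) hinges on how the cost of a swap is measured. Adding the total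
  variation distances of the single coordinates would give order \<epsilon> * m, which vanishes only
  for m below n to the power 1 / (r - 1). The Hellinger affinity is multiplicative and differs from
  1 by order \<epsilon>^2 per coordinate, so the whole swap costs the square root of m *
  \<epsilon>^2. The constant in this bound is governed by the smallest coordinate of
  \<open>q\<close>. The obstacle is that the adversary knows the parameters, so exchanging two users
  is not a symmetry of the model: traces move while parameters stay. The swap is therefore carried
  out for fixed parameters, inside a finite sum over permutations and location arrays. The law of
  the parameters enters only through the random number N of near users, as the mean of 1 / sqrt N.
  The identity E (G^2) = E (Z 1 * G) holds because G is a function of the adversary's knowledge:
  against such a function the posterior and the indicator have the same mean.\<close>

lemma one_minus_prod_le_sum:
  fixes a :: "'c \<Rightarrow> real"
  assumes "finite D" "\<And>c. c \<in> D \<Longrightarrow> 0 \<le> a c" "\<And>c. c \<in> D \<Longrightarrow> a c \<le> 1"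
  shows "1 - (\<Prod>c\<in>D. a c) \<le> (\<Sum>c\<in>D. 1 - a c)"
  using assms
proof (induction D rule: finite_induct)
  case (insert c D)
  have "0 \<le> (1 - a c) * (1 - (\<Prod>c\<in>D. a c))"
    using insert by (intro mult_nonneg_nonneg) (auto intro!: prod_le_1)
  then show ?case
    using insert by (auto simp: algebra_simps)
qed simp

text \<open>The Hellinger affinity is multiplicative over coordinates, so it controls the total
  variation distance of product distributions coordinate by coordinate.\<close>

lemma sum_abs_diff_prod_le_affinity:
  fixes a b :: "'c \<Rightarrow> 'j \<Rightarrow> real"
  assumes fin: "finite D" "finite B"
    and a0: "\<And>c j. c \<in> D \<Longrightarrow> j \<in> B \<Longrightarrow> 0 \<le> a c j"
    and b0: "\<And>c j. c \<in> D \<Longrightarrow> j \<in> B \<Longrightarrow> 0 \<le> b c j"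
    and a1: "\<And>c. c \<in> D \<Longrightarrow> (\<Sum>j\<in>B. a c j) = 1"
    and b1: "\<And>c. c \<in> D \<Longrightarrow> (\<Sum>j\<in>B. b c j) = 1"
  shows "(\<Sum>x\<in>D \<rightarrow>\<^sub>E B. \<bar>(\<Prod>c\<in>D. a c (x c)) - (\<Prod>c\<in>D. b c (x c))\<bar>)
           \<le> sqrt (8 * (\<Sum>c\<in>D. 1 - (\<Sum>j\<in>B. sqrt (a c j * b c j))))"
proof -
  define u v where "u x = (\<Prod>c\<in>D. a c (x c))" and "v x = (\<Prod>c\<in>D. b c (x c))" for x
  define S where "S = (D \<rightarrow>\<^sub>E B)"
  define A where "A = (\<Sum>x\<in>S. sqrt (u x * v x))"
  have u0: "0 \<le> u x" and v0: "0 \<le> v x" if "x \<in> S" for x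
    using that a0 b0 by (auto simp: u_def v_def S_def PiE_iff intro!: prod_nonneg)
  have su: "(\<Sum>x\<in>S. u x) = 1" and sv: "(\<Sum>x\<in>S. v x) = 1"
    unfolding u_def v_def S_def using prod_sum_PiE[of D "\<lambda>_. B" a] prod_sum_PiE[of D "\<lambda>_. B" b] fin a1 b1 by auto
  have sqrt_prod: "sqrt (\<Prod>c\<in>D. g c) = (\<Prod>c\<in>D. sqrt (g c))" for g :: "'c \<Rightarrow> real"
    using fin(1) by (induction D rule: finite_induct) (auto simp: real_sqrt_mult)
  have A: "A = (\<Prod>c\<in>D. \<Sum>j\<in>B. sqrt (a c j * b c j))"
    using prod_sum_PiE[of D "\<lambda>_. B" "\<lambda>c j. sqrt (a c j * b c j)"] fin
    by (simp add: A_def u_def v_def S_def sqrt_prod flip: prod.distrib)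
  have aff: "(\<Sum>j\<in>B. sqrt (a c j * b c j)) \<le> 1" if "c \<in> D" for c
  proof -
    have "(\<Sum>j\<in>B. sqrt (a c j * b c j)) \<le> (\<Sum>j\<in>B. (a c j + b c j) / 2)"
      using that a0 b0 by (intro sum_mono arith_geo_mean_sqrt) auto
    also have "\<dots> = 1"
      using that by (simp add: a1 b1 sum.distrib flip: sum_divide_distrib)
    finally show ?thesis .
  qed
  have A_ge: "1 - A \<le> (\<Sum>c\<in>D. 1 - (\<Sum>j\<in>B. sqrt (a c j * b c j)))"
    unfolding A using fin a0 b0 aff by (intro one_minus_prod_le_sum sum_nonneg) auto
  have A_le: "A \<le> 1"
    unfolding A using a0 b0 aff by (intro prod_le_1 conjI sum_nonneg) auto
  have minus: "(\<Sum>x\<in>S. (sqrt (u x) - sqrt (v x))\<^sup>2) = 2 - 2 * A"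
  proof -
    have "(\<Sum>x\<in>S. (sqrt (u x) - sqrt (v x))\<^sup>2) = (\<Sum>x\<in>S. u x + v x - 2 * sqrt (u x * v x))"
      using u0 v0 by (intro sum.cong) (auto simp: power2_diff real_sqrt_mult)
    then show ?thesis
      by (simp add: sum.distrib sum_subtractf su sv A_def sum_distrib_left)
  qed
  have plus: "(\<Sum>x\<in>S. (sqrt (u x) + sqrt (v x))\<^sup>2) = 2 + 2 * A"
  proof -
    have "(\<Sum>x\<in>S. (sqrt (u x) + sqrt (v x))\<^sup>2) = (\<Sum>x\<in>S. u x + v x + 2 * sqrt (u x * v x))"
      using u0 v0 by (intro sum.cong) (auto simp: power2_sum real_sqrt_mult)
    then show ?thesis
      by (simp add: sum.distrib su sv A_def sum_distrib_left)
  qed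
  \<comment> \<open>Factoring a difference as a difference of square roots times their sum lets
    Cauchy-Schwarz separate 2 - 2 * A, the squared Hellinger distance, from a factor that is at most
    4.\<close>
  have "(\<Sum>x\<in>S. \<bar>u x - v x\<bar>)\<^sup>2 = (\<Sum>x\<in>S. \<bar>sqrt (u x) - sqrt (v x)\<bar> * (sqrt (u x) + sqrt (v x)))\<^sup>2"
  proof (intro arg_cong[where f="\<lambda>x. x\<^sup>2"] sum.cong refl)
    fix x assume x: "x \<in> S"
    have "u x - v x = (sqrt (u x) - sqrt (v x)) * (sqrt (u x) + sqrt (v x))"
      using u0[OF x] v0[OF x] by (simp add: algebra_simps)
    then show "\<bar>u x - v x\<bar> = \<bar>sqrt (u x) - sqrt (v x)\<bar> * (sqrt (u x) + sqrt (v x))"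
      using u0[OF x] v0[OF x] by (simp add: abs_mult)
  qed
  also have "\<dots> \<le> (\<Sum>x\<in>S. \<bar>sqrt (u x) - sqrt (v x)\<bar>\<^sup>2) * (\<Sum>x\<in>S. (sqrt (u x) + sqrt (v x))\<^sup>2)"
    by (rule Cauchy_Schwarz_ineq_sum)
  also have "\<dots> = (2 - 2 * A) * (2 + 2 * A)"
    by (simp add: minus plus)
  also have "\<dots> \<le> (2 - 2 * A) * 4"
    using A_le by (intro mult_left_mono) auto
  also have "\<dots> \<le> 8 * (\<Sum>c\<in>D. 1 - (\<Sum>j\<in>B. sqrt (a c j * b c j)))"
    using A_ge by simp
  finally show ?thesis
    unfolding u_def v_def S_def by (rule real_le_rsqrt)
qed

text \<open>Twice the left side is the sum of the squares of sqrt (a j) - sqrt (b j), and each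
  square equals (a j - b j)^2 / (sqrt (a j) + sqrt (b j))^2 with denominator at least
  \<open>a j\<close>. The loss is thus quadratic in \<open>\<epsilon>\<close>.\<close>

lemma one_minus_affinity_le:
  fixes a b :: "'j \<Rightarrow> real"
  assumes a: "0 < \<kappa>" "\<And>j. j \<in> B \<Longrightarrow> \<kappa> \<le> a j" and b: "\<And>j. j \<in> B \<Longrightarrow> 0 \<le> b j"
    and sum1: "(\<Sum>j\<in>B. a j) = 1" "(\<Sum>j\<in>B. b j) = 1"
    and close: "\<And>j. j \<in> B \<Longrightarrow> \<bar>b j - a j\<bar> \<le> \<epsilon>"
  shows "1 - (\<Sum>j\<in>B. sqrt (a j * b j)) \<le> real (card B) * \<epsilon>\<^sup>2 / (2 * \<kappa>)"
proof -
  have "2 * (1 - (\<Sum>j\<in>B. sqrt (a j * b j))) = (\<Sum>j\<in>B. a j + b j - 2 * sqrt (a j * b j))"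
    using sum1 by (simp add: sum.distrib sum_subtractf sum_distrib_left)
  also have "\<dots> \<le> (\<Sum>j\<in>B. \<epsilon>\<^sup>2 / \<kappa>)"
  proof (rule sum_mono)
    fix j assume j: "j \<in> B"
    have a0: "0 < a j" using a(1) a(2)[OF j] by linarith
    have "(a j + b j - 2 * sqrt (a j * b j)) = (sqrt (a j) - sqrt (b j))\<^sup>2"
      using a0 b[OF j] by (simp add: power2_diff real_sqrt_mult)
    moreover have "(sqrt (a j) - sqrt (b j))\<^sup>2 * \<kappa> \<le> (sqrt (a j) - sqrt (b j))\<^sup>2 * (sqrt (a j) + sqrt (b j))\<^sup>2"
    proof (rule mult_left_mono)
      have "\<kappa> \<le> (sqrt (a j))\<^sup>2" using a(2)[OF j] a0 by simp
      also have "\<dots> \<le> (sqrt (a j) + sqrt (b j))\<^sup>2"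
        using a0 b[OF j] by (intro power_mono) auto
      finally show "\<kappa> \<le> (sqrt (a j) + sqrt (b j))\<^sup>2" .
    qed simp
    moreover have "(sqrt (a j) - sqrt (b j))\<^sup>2 * (sqrt (a j) + sqrt (b j))\<^sup>2 = (b j - a j)\<^sup>2"
    proof -
      have "(sqrt (a j) - sqrt (b j)) * (sqrt (a j) + sqrt (b j)) = a j - b j"
        using a0 b[OF j] by (simp add: algebra_simps)
      then show ?thesis
        by (metis power_mult_distrib power2_commute)
    qed
    moreover have "(b j - a j)\<^sup>2 \<le> \<epsilon>\<^sup>2"
      using close[OF j] by (metis abs_ge_zero power2_abs power_mono)
    ultimately show "a j + b j - 2 * sqrt (a j * b j) \<le> \<epsilon>\<^sup>2 / \<kappa>"
      using a(1) by (simp add: field_simps)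
  qed
  finally show ?thesis
    using a(1) by (simp add: field_simps)
qed

text \<open>\<open>\<phi>\<close> and \<open>\<psi>\<close> are absorbed into the factors
  \<open>c\<close> and \<open>d\<close>; every other factor sums to 1 and drops out. This is the
  independence behind the off-diagonal terms of the second moment below.\<close>

lemma sum_prod_PiE_two_coordinates:
  fixes a :: "'c \<Rightarrow> 'j \<Rightarrow> real"
  assumes fin: "finite D" "finite B" and a1: "\<And>c. c \<in> D \<Longrightarrow> (\<Sum>j\<in>B. a c j) = 1"
    and cd: "c \<in> D" "d \<in> D" "c \<noteq> d"
  shows "(\<Sum>x\<in>D \<rightarrow>\<^sub>E B. (\<Prod>e\<in>D. a e (x e)) * (\<phi> (x c) * \<psi> (x d)))
           = (\<Sum>j\<in>B. a c j * \<phi> j) * (\<Sum>j\<in>B. a d j * \<psi> j)"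
proof -
  define h where "h e j = a e j * (if e = c then \<phi> j else if e = d then \<psi> j else 1)" for e j
  have "(\<Prod>e\<in>D. if e = c then \<phi> (x e) else if e = d then \<psi> (x e) else 1) = \<phi> (x c) * \<psi> (x d)" for x
  proof -
    have "(\<Prod>e\<in>D. if e = c then \<phi> (x e) else if e = d then \<psi> (x e) else 1)
       = (\<Prod>e\<in>{c, d}. if e = c then \<phi> (x e) else if e = d then \<psi> (x e) else 1)"
      using fin cd by (intro prod.mono_neutral_right) auto
    then show ?thesis using cd by simp
  qed
  then have "(\<Sum>x\<in>D \<rightarrow>\<^sub>E B. (\<Prod>e\<in>D. a e (x e)) * (\<phi> (x c) * \<psi> (x d))) = (\<Sum>x\<in>D \<rightarrow>\<^sub>E B. \<Prod>e\<in>D. h e (x e))"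
    by (simp add: h_def prod.distrib)
  also have "\<dots> = (\<Prod>e\<in>D. \<Sum>j\<in>B. h e j)"
    using prod_sum_PiE[of D "\<lambda>_. B" h] fin by simp
  also have "\<dots> = (\<Prod>e\<in>{c, d}. \<Sum>j\<in>B. h e j)"
    using fin cd a1 by (intro prod.mono_neutral_right) (auto simp: h_def)
  finally show ?thesis
    using cd by (simp add: h_def)
qed

text \<open>The first absolute moment is bounded by the second: diagonal terms are at most 1, and
  off the diagonal independence leaves a product of two means. These means need not vanish, since
  \<open>\<zeta>\<close> will be centred at the parameter of user 1 while the coordinates belong to
  users merely close to it; \<open>\<epsilon>\<close> absorbs the bias.\<close>

lemma sum_prod_PiE_abs_sum_le:
  fixes a :: "'c \<Rightarrow> 'j \<Rightarrow> real"
  assumes fin: "finite D" "finite B" and a0: "\<And>c j. c \<in> D \<Longrightarrow> j \<in> B \<Longrightarrow> 0 \<le> a c j"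
    and a1: "\<And>c. c \<in> D \<Longrightarrow> (\<Sum>j\<in>B. a c j) = 1"
    and J: "J \<subseteq> D" and z1: "\<And>j. j \<in> B \<Longrightarrow> \<bar>\<zeta> j\<bar> \<le> 1"
    and mean: "\<And>c. c \<in> J \<Longrightarrow> \<bar>\<Sum>j\<in>B. a c j * \<zeta> j\<bar> \<le> \<epsilon>" and \<epsilon>: "0 \<le> \<epsilon>"
  shows "(\<Sum>x\<in>D \<rightarrow>\<^sub>E B. (\<Prod>e\<in>D. a e (x e)) * \<bar>\<Sum>c\<in>J. \<zeta> (x c)\<bar>)
           \<le> sqrt (real (card J)) + real (card J) * \<epsilon>"
proof -
  define S where "S = (D \<rightarrow>\<^sub>E B)"
  define w where "w x = (\<Prod>e\<in>D. a e (x e))" for x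
  have finJ: "finite J" using J fin finite_subset by blast
  have w0: "0 \<le> w x" if "x \<in> S" for x
    using that a0 by (auto simp: w_def S_def PiE_iff intro!: prod_nonneg)
  have sw: "(\<Sum>x\<in>S. w x) = 1"
    unfolding w_def S_def using prod_sum_PiE[of D "\<lambda>_. B" a] fin a1 by auto
  have pair: "(\<Sum>x\<in>S. w x * (\<zeta> (x c) * \<zeta> (x d))) \<le> (if c = d then 1 else 0) + \<epsilon>\<^sup>2"
    if "c \<in> J" "d \<in> J" for c d
  proof (cases "c = d")
    case True
    have "(\<Sum>x\<in>S. w x * (\<zeta> (x c) * \<zeta> (x d))) \<le> (\<Sum>x\<in>S. w x * 1)"
    proof (intro sum_mono mult_left_mono w0)
      fix x assume "x \<in> S"
      then have "\<bar>\<zeta> (x c)\<bar> \<le> 1" using that J z1 by (auto simp: S_def PiE_iff)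
      then show "\<zeta> (x c) * \<zeta> (x d) \<le> 1"
        using True by (metis abs_le_square_iff abs_one one_power2 power2_eq_square mult_1)
    qed
    then show ?thesis using sw True by (simp add: add_increasing2)
  next
    case False
    have "(\<Sum>x\<in>S. w x * (\<zeta> (x c) * \<zeta> (x d))) = (\<Sum>j\<in>B. a c j * \<zeta> j) * (\<Sum>j\<in>B. a d j * \<zeta> j)"
      unfolding S_def w_def using that J False fin a1 by (intro sum_prod_PiE_two_coordinates) auto
    also have "\<dots> \<le> \<epsilon> * \<epsilon>"
      using mult_mono[OF mean[OF that(1)] mean[OF that(2)]] \<epsilon>
      by (simp flip: abs_mult)
    finally show ?thesis using False by (simp add: power2_eq_square)
  qed
  \<comment> \<open>The weight is split into two square roots, so that one factor in Cauchy-Schwarz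
    is the total mass 1.\<close>
  have "(\<Sum>x\<in>S. w x * \<bar>\<Sum>c\<in>J. \<zeta> (x c)\<bar>)\<^sup>2
      = (\<Sum>x\<in>S. sqrt (w x) * (sqrt (w x) * \<bar>\<Sum>c\<in>J. \<zeta> (x c)\<bar>))\<^sup>2"
    using w0 by (intro arg_cong[where f="\<lambda>x. x\<^sup>2"] sum.cong) (auto simp flip: mult.assoc)
  also have "\<dots> \<le> (\<Sum>x\<in>S. (sqrt (w x))\<^sup>2) * (\<Sum>x\<in>S. (sqrt (w x) * \<bar>\<Sum>c\<in>J. \<zeta> (x c)\<bar>)\<^sup>2)"
    by (rule Cauchy_Schwarz_ineq_sum)
  also have "\<dots> = (\<Sum>x\<in>S. w x * (\<Sum>c\<in>J. \<zeta> (x c))\<^sup>2)"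
    using w0 by (simp add: sw power_mult_distrib)
  also have "\<dots> = (\<Sum>x\<in>S. \<Sum>c\<in>J. \<Sum>d\<in>J. w x * (\<zeta> (x c) * \<zeta> (x d)))"
    by (simp only: power2_eq_square sum_product) (simp only: sum_distrib_left)
  also have "\<dots> = (\<Sum>c\<in>J. \<Sum>x\<in>S. \<Sum>d\<in>J. w x * (\<zeta> (x c) * \<zeta> (x d)))"
    by (rule sum.swap)
  also have "\<dots> = (\<Sum>c\<in>J. \<Sum>d\<in>J. \<Sum>x\<in>S. w x * (\<zeta> (x c) * \<zeta> (x d)))"
    by (intro sum.cong refl sum.swap)
  \<comment> \<open>The bias term is granted on the diagonal too, which makes its double sum a
    perfect square.\<close>
  also have "\<dots> \<le> (\<Sum>c\<in>J. \<Sum>d\<in>J. (if c = d then 1 else 0) + \<epsilon>\<^sup>2)"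
    by (intro sum_mono pair)
  also have "\<dots> = real (card J) + (real (card J) * \<epsilon>)\<^sup>2"
    using finJ by (simp add: sum.distrib power2_eq_square algebra_simps)
  also have "\<dots> \<le> (sqrt (real (card J)) + real (card J) * \<epsilon>)\<^sup>2"
    using \<epsilon> by (simp add: power2_sum)
  finally show ?thesis
    unfolding S_def w_def by (rule power2_le_imp_le) (use \<epsilon> in simp)
qed

section \<open>Exchanging two users\<close>

text \<open>Conditional law of the locations at the (user, time) pairs in \<open>D\<close>, given
  the parameters \<open>P\<close>. A factor depends on the pair only through its user, so exchanging
  users is a relabelling of \<open>P\<close>.\<close>

definition locations_pmf :: "(nat \<Rightarrow> nat \<Rightarrow> real) \<Rightarrow> (nat \<times> nat) set \<Rightarrow> (nat \<times> nat \<Rightarrow> nat) \<Rightarrow> real" where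
  "locations_pmf P D x = (\<Prod>c\<in>D. P (fst c) (x c))"

lemma locations_pmf_nonneg:
  assumes "\<And>c. c \<in> D \<Longrightarrow> prob_vector r (P (fst c))" "x \<in> D \<rightarrow>\<^sub>E {..<r}"
  shows "0 \<le> locations_pmf P D x"
  using assms unfolding locations_pmf_def prob_vector_def by (intro prod_nonneg) (auto simp: PiE_iff)

lemma finite_permutations_upto [simp]: "finite (permutations_upto n)"
  unfolding permutations_upto_def by (rule finite_permutations) simp

lemma card_permutations_upto [simp]: "card (permutations_upto n) = fact n"
  unfolding permutations_upto_def by (rule card_permutations) simp_all

lemma permutations_upto_swap:
  assumes "\<pi> \<in> permutations_upto n" "u \<in> {1..n}"
  shows "\<pi> \<circ> Transposition.transpose 1 u \<in> permutations_upto n"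
  using assms unfolding permutations_upto_def
  by (auto intro!: permutes_compose permutes_swap_id)

text \<open>The index set is an argument because arrays must stay extensional. It will be a
  rectangle of users and times, which the exchange of two users maps to itself.\<close>

definition swap_users :: "nat \<Rightarrow> (nat \<times> nat) set \<Rightarrow> (nat \<times> nat \<Rightarrow> nat) \<Rightarrow> nat \<times> nat \<Rightarrow> nat" where
  "swap_users u D x = (\<lambda>(w, t)\<in>D. x (Transposition.transpose 1 u w, t))"

lemma transpose_mem_users: "u \<in> {1..n} \<Longrightarrow> Transposition.transpose 1 u w \<in> {1..n} \<longleftrightarrow> w \<in> {1..n}" for u w n :: nat
  by (auto simp: Transposition.transpose_def)

lemma swap_users_mem:
  assumes "u \<in> {1..n}" "x \<in> {1..n} \<times> T \<rightarrow>\<^sub>E B"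
  shows "swap_users u ({1..n} \<times> T) x \<in> {1..n} \<times> T \<rightarrow>\<^sub>E B"
  using assms(2) transpose_mem_users[OF assms(1)]
  by (auto simp: swap_users_def PiE_iff simp del: atLeastAtMost_iff)

lemma swap_users_swap_users:
  assumes "u \<in> {1..n}" "x \<in> {1..n} \<times> T \<rightarrow>\<^sub>E B"
  shows "swap_users u ({1..n} \<times> T) (swap_users u ({1..n} \<times> T) x) = x"
  using assms(2) transpose_mem_users[OF assms(1)]
  by (intro ext) (auto simp: swap_users_def PiE_iff restrict_def extensional_def simp del: atLeastAtMost_iff; metis?)

text \<open>The transposition is its own inverse, so reindexing the product moves it from the traces
  to the parameters. A swap thereby becomes a comparison of two product distributions.\<close>

lemma locations_pmf_swap_users:
  assumes "u \<in> {1..n}"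
  shows "locations_pmf P ({1..n} \<times> T) (swap_users u ({1..n} \<times> T) x)
       = locations_pmf (\<lambda>w. P (Transposition.transpose 1 u w)) ({1..n} \<times> T) x"
  unfolding locations_pmf_def
  by (rule prod.reindex_bij_witness[where i="\<lambda>(w, t). (Transposition.transpose 1 u w, t)" and j="\<lambda>(w, t). (Transposition.transpose 1 u w, t)"])
     (use transpose_mem_users[OF assms] in \<open>auto simp: swap_users_def simp del: atLeastAtMost_iff\<close>)

text \<open>Only the coordinates of users 1 and \<open>u\<close> change their law, and for both the
  two laws compared are \<open>P 1\<close> and \<open>P u\<close>; the affinity is symmetric, so the
  lower bound for \<open>P 1\<close> serves twice. All other coordinates have affinity 1 and cost
  nothing.\<close>

lemma swap_error_le:
  assumes T: "finite T" and u: "u \<in> {1..n}"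
    and P: "\<And>w. w \<in> {1..n} \<Longrightarrow> prob_vector r (P w)"
    and \<kappa>: "0 < \<kappa>" "\<And>j. j < r \<Longrightarrow> \<kappa> \<le> P 1 j"
    and close: "\<And>j. j < r \<Longrightarrow> \<bar>P u j - P 1 j\<bar> \<le> \<epsilon>"
  shows "(\<Sum>x\<in>{1..n} \<times> T \<rightarrow>\<^sub>E {..<r}. \<bar>locations_pmf (\<lambda>w. P (Transposition.transpose 1 u w)) ({1..n} \<times> T) x
            - locations_pmf P ({1..n} \<times> T) x\<bar>) \<le> sqrt (8 * (real (card T) * real r * \<epsilon>\<^sup>2 / \<kappa>))"
proof -
  define a b where "a c j = P (Transposition.transpose 1 u (fst c)) j" and "b c j = P (fst c) j" for c :: "nat \<times> nat" and j
  define D where "D = {1..n} \<times> T"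
  define s where "s = real r * \<epsilon>\<^sup>2 / (2 * \<kappa>)"
  have s0: "0 \<le> s" using \<kappa>(1) by (simp add: s_def)
  have [simp]: "finite D" using T by (simp add: D_def)
  have trans: "Transposition.transpose 1 u (fst c) \<in> {1..n}" if "c \<in> D" for c
    using that by (subst transpose_mem_users[OF u]) (auto simp: D_def)
  have ge1: "1 \<in> {1..n}" using u by auto
  have sq: "(\<Sum>j<r. sqrt (P w j * P w j)) = 1" if "w \<in> {1..n}" for w
    using P[OF that] by (simp add: prob_vector_def)
  have aff1: "1 - (\<Sum>j<r. sqrt (P 1 j * P u j)) \<le> s"
    unfolding s_def using one_minus_affinity_le[of \<kappa> "{..<r}" "P 1" "P u" \<epsilon>] \<kappa> close P[OF ge1] P[OF u]
    by (simp add: prob_vector_def)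
  have "(\<Sum>x\<in>D \<rightarrow>\<^sub>E {..<r}. \<bar>(\<Prod>c\<in>D. a c (x c)) - (\<Prod>c\<in>D. b c (x c))\<bar>)
      \<le> sqrt (8 * (\<Sum>c\<in>D. 1 - (\<Sum>j<r. sqrt (a c j * b c j))))"
    using trans P T by (intro sum_abs_diff_prod_le_affinity) (auto simp: D_def a_def b_def prob_vector_def)
  \<comment> \<open>With two separate indicators \<open>u = 1\<close> needs no case of its own: it
    is counted twice, which is harmless since \<open>s\<close> is nonnegative.\<close>
  also have "\<dots> \<le> sqrt (8 * (\<Sum>c\<in>D. (if fst c = 1 then s else 0) + (if fst c = u then s else 0)))"
  proof (intro real_sqrt_le_mono mult_left_mono sum_mono)
    fix c assume c: "c \<in> D"
    have cn: "fst c \<in> {1..n}" using c by (auto simp: D_def)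
    consider "fst c = 1" | "fst c = u" | "fst c \<noteq> 1" "fst c \<noteq> u" by blast
    then show "1 - (\<Sum>j<r. sqrt (a c j * b c j)) \<le> (if fst c = 1 then s else 0) + (if fst c = u then s else 0)"
    proof cases
      case 1
      then show ?thesis using aff1 s0 by (auto simp: a_def b_def mult.commute)
    next
      case 2
      then show ?thesis using aff1 s0 by (auto simp: a_def b_def)
    next
      case 3
      then show ?thesis using sq[OF cn] by (simp add: a_def b_def)
    qed
  qed simp
  also have "(\<Sum>c\<in>D. (if fst c = 1 then s else 0) + (if fst c = u then s else 0)) = real (card T) * (2 * s)"
  proof -
    have "(\<Sum>c\<in>D. if fst c = v then s else 0) = real (card T) * s" if "v \<in> {1..n}" for v
    proof -
      have "(\<Sum>c\<in>D. if fst c = v then s else 0) = (\<Sum>w\<in>{1..n}. \<Sum>t\<in>T. if w = v then s else 0)"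
        unfolding D_def by (subst sum.cartesian_product) (simp add: split_def)
      also have "\<dots> = (\<Sum>w\<in>{1..n}. if w = v then real (card T) * s else 0)"
        by (intro sum.cong) auto
      finally show ?thesis using that by simp
    qed
    then show ?thesis using u ge1 by (simp add: sum.distrib)
  qed
  finally show ?thesis
    by (simp add: locations_pmf_def a_def b_def D_def s_def mult.assoc)
qed

text \<open>Swapping users 1 and \<open>u\<close> leaves the observations unchanged and moves the centred
  indicator from user 1 to user \<open>u\<close>; averaging over all \<open>u\<close> in \<open>J\<close> then produces an empirical mean.\<close>

lemma abs_sum_centred_indicator_le:
  assumes T: "finite T" "k \<in> T" and J: "J \<subseteq> {1..n}" "1 \<in> J"
    and P: "\<And>w. w \<in> {1..n} \<Longrightarrow> prob_vector r (P w)"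
    and \<kappa>: "0 < \<kappa>" "\<And>j. j < r \<Longrightarrow> \<kappa> \<le> P 1 j"
    and close: "\<And>u j. u \<in> J \<Longrightarrow> j < r \<Longrightarrow> \<bar>P u j - P 1 j\<bar> \<le> \<epsilon>" and i: "i < r"
    and G1: "\<And>\<pi> x. \<pi> \<in> permutations_upto n \<Longrightarrow> x \<in> {1..n} \<times> T \<rightarrow>\<^sub>E {..<r} \<Longrightarrow> \<bar>G \<pi> x\<bar> \<le> 1"
    and G_swap: "\<And>\<pi> x u. \<pi> \<in> permutations_upto n \<Longrightarrow> x \<in> {1..n} \<times> T \<rightarrow>\<^sub>E {..<r} \<Longrightarrow> u \<in> {1..n} \<Longrightarrow>
           G (\<pi> \<circ> Transposition.transpose 1 u) (swap_users u ({1..n} \<times> T) x) = G \<pi> x"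
  shows "\<bar>\<Sum>\<pi>\<in>permutations_upto n. \<Sum>x\<in>{1..n} \<times> T \<rightarrow>\<^sub>E {..<r}.
            locations_pmf P ({1..n} \<times> T) x * ((of_bool (x (1, k) = i) - P 1 i) * G \<pi> x)\<bar>
         \<le> fact n * (1 / sqrt (real (card J)) + \<epsilon> + sqrt (8 * (real (card T) * real r * \<epsilon>\<^sup>2 / \<kappa>)))"
proof -
  define D where "D = {1..n} \<times> T"
  define S where "S = (D \<rightarrow>\<^sub>E {..<r})"
  define Q where "Q = permutations_upto n"
  define e where "e = sqrt (8 * (real (card T) * real r * \<epsilon>\<^sup>2 / \<kappa>))"
  define z where "z j = of_bool (j = i) - P 1 i" for j
  define h where "h u = (\<Sum>\<pi>\<in>Q. \<Sum>x\<in>S. locations_pmf P D x * (z (x (u, k)) * G \<pi> x))" for u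
  have finD: "finite D" using T by (simp add: D_def)
  have \<epsilon>: "0 \<le> \<epsilon>" using close[OF J(2) i] by simp
  have ge1: "1 \<in> {1..n}" using J by auto
  have P1i: "0 \<le> P 1 i" "P 1 i \<le> 1"
    using P[OF ge1] i member_le_sum[of i "{..<r}" "P 1"] by (auto simp: prob_vector_def)
  have z1: "\<bar>z j\<bar> \<le> 1" for j
    using P1i by (auto simp: z_def)
  have D: "c \<in> D \<Longrightarrow> prob_vector r (P (fst c))" for c
    using P by (auto simp: D_def)
  have G1': "\<bar>G \<pi> x\<bar> \<le> 1" if "\<pi> \<in> Q" "x \<in> S" for \<pi> x
    using that G1 by (auto simp: Q_def S_def D_def)
  have swap: "\<bar>h 1 - h u\<bar> \<le> fact n * e" if u: "u \<in> J" for u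
  proof -
    have un: "u \<in> {1..n}" using u J by auto
    \<comment> \<open>Both summation variables are reindexed by involutions: permutations by
      composition with the transposition, arrays by \<open>swap_users\<close>.\<close>
    have "h 1 = (\<Sum>\<pi>\<in>Q. \<Sum>x\<in>S. locations_pmf P D (swap_users u D x)
                  * (z (swap_users u D x (1, k)) * G (\<pi> \<circ> Transposition.transpose 1 u) (swap_users u D x)))"
    proof -
      have 1: "h 1 = (\<Sum>\<pi>\<in>Q. \<Sum>x\<in>S. locations_pmf P D x * (z (x (1, k)) * G (\<pi> \<circ> Transposition.transpose 1 u) x))"
        unfolding h_def
        by (rule sum.reindex_bij_witness[where i="\<lambda>\<pi>. \<pi> \<circ> Transposition.transpose 1 u" and j="\<lambda>\<pi>. \<pi> \<circ> Transposition.transpose 1 u"])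
           (use un permutations_upto_swap in \<open>auto simp: Q_def comp_assoc\<close>)
      show ?thesis
        unfolding 1
        by (intro sum.cong refl sum.reindex_bij_witness[where i="swap_users u D" and j="swap_users u D"])
           (use un swap_users_mem swap_users_swap_users in \<open>auto simp: S_def D_def simp del: atLeastAtMost_iff\<close>)
    qed
    \<comment> \<open>By \<open>G_swap\<close> the function \<open>G\<close> is back at its original
      arguments, and the indicator now reads user \<open>u\<close>. Only the weights still carry the
      swap, so the difference from \<open>h u\<close> is a total variation error.\<close>
    also have "\<dots> = (\<Sum>\<pi>\<in>Q. \<Sum>x\<in>S. locations_pmf (\<lambda>w. P (Transposition.transpose 1 u w)) D x * (z (x (u, k)) * G \<pi> x))"
    proof (intro sum.cong refl)
      fix \<pi> x assume "\<pi> \<in> Q" "x \<in> S"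
      moreover have "swap_users u D x (1, k) = x (u, k)"
        using ge1 T by (simp add: swap_users_def D_def)
      ultimately show "locations_pmf P D (swap_users u D x)
                  * (z (swap_users u D x (1, k)) * G (\<pi> \<circ> Transposition.transpose 1 u) (swap_users u D x))
          = locations_pmf (\<lambda>w. P (Transposition.transpose 1 u w)) D x * (z (x (u, k)) * G \<pi> x)"
        using G_swap[of \<pi> x u] un locations_pmf_swap_users[OF un, of P T x] by (simp add: Q_def S_def D_def)
    qed
    finally have "h 1 - h u = (\<Sum>\<pi>\<in>Q. \<Sum>x\<in>S.
        (locations_pmf (\<lambda>w. P (Transposition.transpose 1 u w)) D x - locations_pmf P D x) * (z (x (u, k)) * G \<pi> x))"
      by (simp add: h_def sum_subtractf algebra_simps)
    also have "\<bar>\<dots>\<bar> \<le> (\<Sum>\<pi>\<in>Q. \<Sum>x\<in>S. \<bar>(locations_pmf (\<lambda>w. P (Transposition.transpose 1 u w)) D x - locations_pmf P D x) * (z (x (u, k)) * G \<pi> x)\<bar>)"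
      by (intro order_trans[OF sum_abs] sum_mono) simp
    also have "\<dots> \<le> (\<Sum>\<pi>\<in>Q. \<Sum>x\<in>S. \<bar>locations_pmf (\<lambda>w. P (Transposition.transpose 1 u w)) D x - locations_pmf P D x\<bar>)"
    proof (intro sum_mono)
      fix \<pi> x assume "\<pi> \<in> Q" "x \<in> S"
      then have "\<bar>z (x (u, k)) * G \<pi> x\<bar> \<le> 1"
        unfolding abs_mult using z1 G1' by (intro mult_le_one) auto
      then show "\<bar>(locations_pmf (\<lambda>w. P (Transposition.transpose 1 u w)) D x - locations_pmf P D x) * (z (x (u, k)) * G \<pi> x)\<bar>
          \<le> \<bar>locations_pmf (\<lambda>w. P (Transposition.transpose 1 u w)) D x - locations_pmf P D x\<bar>"
        by (subst abs_mult) (rule mult_left_le, simp_all)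
    qed
    also have "\<dots> \<le> (\<Sum>\<pi>\<in>Q. e)"
      unfolding S_def D_def e_def using T un P \<kappa> close[OF u] by (intro sum_mono swap_error_le) auto
    also have "\<dots> = fact n * e" by (simp add: Q_def)
    finally show ?thesis .
  qed
  \<comment> \<open>\<open>G\<close> does not depend on the user, so the sum over \<open>J\<close>
    acts on the centred indicators alone; bounding \<open>G\<close> by 1 then leaves an absolute
    moment of independent variables.\<close>
  have mean: "\<bar>\<Sum>u\<in>J. h u\<bar> \<le> fact n * (sqrt (real (card J)) + real (card J) * \<epsilon>)"
  proof -
    have "(\<Sum>u\<in>J. h u) = (\<Sum>\<pi>\<in>Q. \<Sum>x\<in>S. \<Sum>u\<in>J. locations_pmf P D x * (z (x (u, k)) * G \<pi> x))"
    proof -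
      have "(\<Sum>u\<in>J. h u) = (\<Sum>\<pi>\<in>Q. \<Sum>u\<in>J. \<Sum>x\<in>S. locations_pmf P D x * (z (x (u, k)) * G \<pi> x))"
        unfolding h_def by (rule sum.swap)
      also have "\<dots> = (\<Sum>\<pi>\<in>Q. \<Sum>x\<in>S. \<Sum>u\<in>J. locations_pmf P D x * (z (x (u, k)) * G \<pi> x))"
        by (rule sum.cong[OF refl], rule sum.swap)
      finally show ?thesis .
    qed
    also have "\<dots> = (\<Sum>\<pi>\<in>Q. \<Sum>x\<in>S. locations_pmf P D x * ((\<Sum>u\<in>J. z (x (u, k))) * G \<pi> x))"
      by (simp add: sum_distrib_left sum_distrib_right)
    also have "\<bar>\<dots>\<bar> \<le> (\<Sum>\<pi>\<in>Q. \<Sum>x\<in>S. \<bar>locations_pmf P D x * ((\<Sum>u\<in>J. z (x (u, k))) * G \<pi> x)\<bar>)"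
      by (intro order_trans[OF sum_abs] sum_mono) simp
    also have "\<dots> \<le> (\<Sum>\<pi>\<in>Q. \<Sum>x\<in>S. locations_pmf P D x * \<bar>\<Sum>u\<in>J. z (x (u, k))\<bar>)"
    proof (intro sum_mono)
      fix \<pi> x assume *: "\<pi> \<in> Q" "x \<in> S"
      have "0 \<le> locations_pmf P D x"
        using * D by (intro locations_pmf_nonneg[of _ r]) (auto simp: S_def)
      then show "\<bar>locations_pmf P D x * ((\<Sum>u\<in>J. z (x (u, k))) * G \<pi> x)\<bar> \<le> locations_pmf P D x * \<bar>\<Sum>u\<in>J. z (x (u, k))\<bar>"
        unfolding abs_mult using G1'[OF *] by (simp add: mult_left_mono mult_left_le)
    qed
    also have "\<dots> \<le> (\<Sum>\<pi>\<in>Q. sqrt (real (card J)) + real (card J) * \<epsilon>)"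
    proof (rule sum_mono)
      have inj: "inj_on (\<lambda>u. (u, k)) J" by (auto simp: inj_on_def)
      \<comment> \<open>Under the law of user \<open>u\<close> the indicator has mean
        \<open>P u i\<close>; centring at \<open>P 1 i\<close> leaves the difference that closeness
        controls.\<close>
      have m: "\<bar>\<Sum>j<r. P u j * z j\<bar> \<le> \<epsilon>" if "u \<in> J" for u
      proof -
        have "(\<Sum>j<r. P u j * z j) = (\<Sum>j<r. if j = i then P u j else 0) - (\<Sum>j<r. P u j) * P 1 i"
          unfolding sum_distrib_right sum_subtractf[symmetric]
          by (intro sum.cong) (simp_all add: z_def right_diff_distrib)
        then have "(\<Sum>j<r. P u j * z j) = P u i - P 1 i"
          using i P[of u] that J by (auto simp: prob_vector_def)
        then show ?thesis using close[OF that i] by simp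
      qed
      have "(\<Sum>x\<in>S. (\<Prod>c\<in>D. P (fst c) (x c)) * \<bar>\<Sum>c\<in>(\<lambda>u. (u, k)) ` J. z (x c)\<bar>)
          \<le> sqrt (real (card ((\<lambda>u. (u, k)) ` J))) + real (card ((\<lambda>u. (u, k)) ` J)) * \<epsilon>"
        unfolding S_def using finD D J T z1 m \<epsilon>
        by (intro sum_prod_PiE_abs_sum_le) (auto simp: D_def prob_vector_def)
      then show "(\<Sum>x\<in>S. locations_pmf P D x * \<bar>\<Sum>u\<in>J. z (x (u, k))\<bar>) \<le> sqrt (real (card J)) + real (card J) * \<epsilon>"
        by (simp add: card_image inj sum.reindex locations_pmf_def)
    qed
    finally show ?thesis by (simp add: Q_def)
  qed
  have cJ: "0 < real (card J)"
    using J finite_subset[OF J(1)] by (auto simp: card_gt_0_iff)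
  have "real (card J) * h 1 = (\<Sum>u\<in>J. h 1 - h u) + (\<Sum>u\<in>J. h u)"
    by (simp add: sum_subtractf)
  then have "real (card J) * \<bar>h 1\<bar> \<le> \<bar>\<Sum>u\<in>J. h 1 - h u\<bar> + \<bar>\<Sum>u\<in>J. h u\<bar>"
    by (metis abs_triangle_ineq abs_mult abs_of_nat)
  also have "\<bar>\<Sum>u\<in>J. h 1 - h u\<bar> \<le> (\<Sum>u\<in>J. fact n * e)"
    using swap by (intro order_trans[OF sum_abs] sum_mono)
  finally have "real (card J) * \<bar>h 1\<bar> \<le> real (card J) * (fact n * e) + fact n * (sqrt (real (card J)) + real (card J) * \<epsilon>)"
    using mean by simp
  also have "\<dots> = real (card J) * (fact n * (1 / sqrt (real (card J)) + \<epsilon> + e))"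
  proof -
    define s where "s = 1 / sqrt (real (card J))"
    have "sqrt (real (card J)) = real (card J) * s"
      using real_div_sqrt[of "real (card J)"] by (simp add: s_def)
    then show ?thesis
      unfolding s_def[symmetric] by (simp add: algebra_simps)
  qed
  finally have "\<bar>h 1\<bar> \<le> fact n * (1 / sqrt (real (card J)) + \<epsilon> + e)"
    using cJ by simp
  then show ?thesis
    by (simp add: h_def Q_def S_def D_def z_def e_def)
qed

section \<open>Mutual information and the chi-square divergence\<close>

text \<open>Both follow from ln x \<le> x - 1, at x = q / g and x = g / q. After averaging, the
  lower bound yields nonnegativity and the upper one the chi-square divergence. For g = 0 the factor
  in front makes the value of the logarithm irrelevant.\<close>

lemma ln_quotient_bounds:
  fixes g q :: real
  assumes "0 \<le> g" "0 < q"
  shows "g - q \<le> g * ln (g / q)" "g * ln (g / q) \<le> g * (g / q - 1)"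
proof -
  show "g * ln (g / q) \<le> g * (g / q - 1)"
    using assms by (cases "g = 0") (auto intro!: mult_left_mono ln_le_minus_one)
  show "g - q \<le> g * ln (g / q)"
  proof (cases "g = 0")
    case False
    then have "g * ln (q / g) \<le> g * (q / g - 1)"
      using assms by (intro mult_left_mono ln_le_minus_one) auto
    then show ?thesis
      using assms False by (simp add: ln_div algebra_simps)
  qed (use assms in auto)
qed

text \<open>The joint law has density \<open>g\<close> with respect to counting measure times the
  law of \<open>Y\<close>, so the mutual information is the sum over \<open>i\<close> of the means
  of g * log (g / q). The posterior is given by an identity of measures because \<open>Y\<close>
  will contain continuous parameters, whose single values may have probability 0.\<close>

lemma (in information_space) mutual_information_le_chi_square:
  fixes g :: "'i \<Rightarrow> 'c \<Rightarrow> real" and q :: "'i \<Rightarrow> real"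
  assumes S: "finite S" and X: "X \<in> measurable M (count_space S)" and Y: "Y \<in> measurable M T"
    and g: "\<And>i. i \<in> S \<Longrightarrow> g i \<in> borel_measurable T"
    and g0: "\<And>i y. i \<in> S \<Longrightarrow> y \<in> space T \<Longrightarrow> 0 \<le> g i y"
    and g1: "\<And>i y. i \<in> S \<Longrightarrow> y \<in> space T \<Longrightarrow> g i y \<le> 1"
    and q0: "\<And>i. i \<in> S \<Longrightarrow> 0 < q i"
    and q: "\<And>i. i \<in> S \<Longrightarrow> prob {\<omega> \<in> space M. X \<omega> = i} = q i"
    and joint: "\<And>i A. i \<in> S \<Longrightarrow> A \<in> sets T \<Longrightarrow>
       emeasure M {\<omega> \<in> space M. X \<omega> = i \<and> Y \<omega> \<in> A} = (\<integral>\<^sup>+\<omega>. ennreal (g i (Y \<omega>)) * indicator A (Y \<omega>) \<partial>M)"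
  shows "0 \<le> mutual_information b (count_space S) T X Y"
    and "mutual_information b (count_space S) T X Y \<le> (\<Sum>i\<in>S. expectation (\<lambda>\<omega>. (g i (Y \<omega>) - q i)\<^sup>2) / q i) / ln b"
proof -
  note [measurable] = X Y
  \<comment> \<open>Mutual information sees \<open>T\<close> only through its sigma-algebra. With
    the law of \<open>Y\<close> as reference measure, the density of \<open>Y\<close> is constantly
    1.\<close>
  define T' where "T' = distr M T Y"
  have sets_T' [measurable_cong]: "sets T' = sets T" and space_T': "space T' = space T"
    by (simp_all add: T'_def)
  interpret T': prob_space T' unfolding T'_def by (rule prob_space_distr) simp
  interpret S: finite_measure "count_space S" by (rule finite_measure_count_space) fact
  interpret ST: pair_sigma_finite "count_space S" T' ..
  have meas_sec [measurable]: "g i \<in> borel_measurable T'" if "i \<in> S" for i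
    using g[OF that] by (simp cong: measurable_cong_sets add: sets_T')
  have Eg: "expectation (\<lambda>\<omega>. g i (Y \<omega>)) = q i" and int_g: "integrable M (\<lambda>\<omega>. g i (Y \<omega>))" if i: "i \<in> S" for i
  proof -
    have [measurable]: "g i \<in> borel_measurable T" using g i by auto
    have gY: "0 \<le> g i (Y \<omega>)" "g i (Y \<omega>) \<le> 1" if "\<omega> \<in> space M" for \<omega>
      using g0[OF i] g1[OF i] measurable_space[OF Y that] by auto
    show int: "integrable M (\<lambda>\<omega>. g i (Y \<omega>))"
      using gY by (intro integrable_const_bound[where B=1]) auto
    have "ennreal (q i) = emeasure M {\<omega> \<in> space M. X \<omega> = i \<and> Y \<omega> \<in> space T}"
      unfolding q[OF i, symmetric] using measurable_space[OF Y]
      by (simp add: emeasure_eq_measure) (metis (mono_tags, lifting))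
    also have "\<dots> = (\<integral>\<^sup>+\<omega>. ennreal (g i (Y \<omega>)) \<partial>M)"
      unfolding joint[OF i sets.top] using measurable_space[OF Y]
      by (intro nn_integral_cong) auto
    also have "\<dots> = ennreal (expectation (\<lambda>\<omega>. g i (Y \<omega>)))"
      using int gY by (intro nn_integral_eq_integral) auto
    finally show "expectation (\<lambda>\<omega>. g i (Y \<omega>)) = q i"
      using q0[OF i] gY by (subst (asm) ennreal_inj) (auto intro!: integral_nonneg_AE simp: less_imp_le)
  qed
  define Pxy where "Pxy = (\<lambda>(i, y). g i y)"
  have Pxy_meas [measurable]: "Pxy \<in> borel_measurable (count_space S \<Otimes>\<^sub>M T')"
    unfolding Pxy_def using S by (intro measurable_pair_measure_countable1) (auto intro: countable_finite)
  have Px: "distributed M (count_space S) X q"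
    unfolding distributed_def
  proof (intro conjI X)
    show "distr M (count_space S) X = density (count_space S) (\<lambda>x. ennreal (q x))"
    proof (rule measure_eqI_finite[of _ S])
      fix i assume i: "i \<in> S"
      have "emeasure (distr M (count_space S) X) {i} = ennreal (q i)"
        using i q[OF i] by (simp add: emeasure_distr emeasure_eq_measure vimage_def Int_def conj_commute)
      also have "\<dots> = emeasure (density (count_space S) (\<lambda>x. ennreal (q x))) {i}"
        using i S by (simp add: emeasure_density nn_integral_count_space_finite indicator_def if_distrib cong: if_cong)
      finally show "emeasure (distr M (count_space S) X) {i} = emeasure (density (count_space S) (\<lambda>x. ennreal (q x))) {i}" .
    qed (use S in auto)
  qed simp
  have Py: "distributed M T' Y (\<lambda>_. ennreal 1)"
  proof -
    have "distr M T' Y = T'"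
      unfolding T'_def by (rule distr_cong) simp_all
    then show ?thesis
      by (simp add: distributed_def density_1)
  qed
  have Pxy: "distributed M (count_space S \<Otimes>\<^sub>M T') (\<lambda>\<omega>. (X \<omega>, Y \<omega>)) Pxy"
    unfolding distributed_def
  proof (intro conjI)
    show "distr M (count_space S \<Otimes>\<^sub>M T') (\<lambda>\<omega>. (X \<omega>, Y \<omega>)) = density (count_space S \<Otimes>\<^sub>M T') (\<lambda>x. ennreal (Pxy x))"
    proof (rule measure_eqI)
      fix A assume "A \<in> sets (distr M (count_space S \<Otimes>\<^sub>M T') (\<lambda>\<omega>. (X \<omega>, Y \<omega>)))"
      then have A [measurable]: "A \<in> sets (count_space S \<Otimes>\<^sub>M T')" by simp
      have sec [measurable]: "Pair i -` A \<in> sets T" for i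
        using sets_Pair1[OF A, of i] by (simp add: sets_T')
      have "emeasure (distr M (count_space S \<Otimes>\<^sub>M T') (\<lambda>\<omega>. (X \<omega>, Y \<omega>))) A
          = emeasure M ((\<lambda>\<omega>. (X \<omega>, Y \<omega>)) -` A \<inter> space M)"
        by (rule emeasure_distr) auto
      also have "(\<lambda>\<omega>. (X \<omega>, Y \<omega>)) -` A \<inter> space M = (\<Union>i\<in>S. {\<omega> \<in> space M. X \<omega> = i \<and> Y \<omega> \<in> Pair i -` A})"
        using measurable_space[OF X] by auto
      also have "emeasure M \<dots> = (\<Sum>i\<in>S. emeasure M {\<omega> \<in> space M. X \<omega> = i \<and> Y \<omega> \<in> Pair i -` A})"
        using S by (intro sum_emeasure[symmetric]) (auto simp: disjoint_family_on_def)
      also have "\<dots> = (\<Sum>i\<in>S. \<integral>\<^sup>+\<omega>. ennreal (g i (Y \<omega>)) * indicator (Pair i -` A) (Y \<omega>) \<partial>M)"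
        by (intro sum.cong refl joint sec)
      also have "\<dots> = (\<Sum>i\<in>S. \<integral>\<^sup>+y. ennreal (g i y) * indicator (Pair i -` A) y \<partial>T')"
        unfolding T'_def using g by (intro sum.cong refl nn_integral_distr[symmetric]) auto
      also have "\<dots> = (\<integral>\<^sup>+i. \<integral>\<^sup>+y. ennreal (Pxy (i, y)) * indicator A (i, y) \<partial>T' \<partial>count_space S)"
        using S by (simp add: nn_integral_count_space_finite Pxy_def indicator_def)
      also have "\<dots> = (\<integral>\<^sup>+x. ennreal (Pxy x) * indicator A x \<partial>(count_space S \<Otimes>\<^sub>M T'))"
        by (subst T'.nn_integral_fst[symmetric]) auto
      also have "\<dots> = emeasure (density (count_space S \<Otimes>\<^sub>M T') (\<lambda>x. ennreal (Pxy x))) A"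
        by (simp add: emeasure_density)
      finally show "emeasure (distr M (count_space S \<Otimes>\<^sub>M T') (\<lambda>\<omega>. (X \<omega>, Y \<omega>))) A
          = emeasure (density (count_space S \<Otimes>\<^sub>M T') (\<lambda>x. ennreal (Pxy x))) A" .
    qed simp
  qed auto
  define f where "f = (\<lambda>i y. g i y * log b (g i y / q i))"
  have lnb: "0 < ln b" using b_gt_1 by simp
  have f_lower: "(g i y - q i) / ln b \<le> f i y" and f_upper: "f i y \<le> (g i y * (g i y / q i - 1)) / ln b"
    if "i \<in> S" "y \<in> space T" for i y
    using ln_quotient_bounds[OF g0[OF that] q0[OF that(1)]] lnb by (simp_all add: f_def log_def divide_right_mono)
  have f_meas [measurable]: "f i \<in> borel_measurable T'" if [simp]: "i \<in> S" for i
    unfolding f_def by measurable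
  have f_bound: "\<bar>f i y\<bar> \<le> (q i + 1 / q i) / ln b" if "i \<in> S" "y \<in> space T" for i y
  proof -
    have *: "g i y * (g i y / q i - 1) \<le> 1 / q i"
      using g0[OF that] g1[OF that] q0[OF that(1)]
      by (smt (verit) divide_right_mono mult_left_le_one_le mult_nonneg_nonneg divide_nonneg_pos mult_mono zero_le_divide_1_iff mult_left_mono)
    have "f i y \<le> (1 / q i) / ln b"
      by (rule order_trans[OF f_upper[OF that] divide_right_mono[OF *]]) (use lnb in simp)
    also have "\<dots> \<le> (q i + 1 / q i) / ln b"
      using q0[OF that(1)] lnb by (intro divide_right_mono) auto
    finally have 1: "f i y \<le> (q i + 1 / q i) / ln b" .
    have "- ((q i + 1 / q i) / ln b) \<le> (g i y - q i) / ln b"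
    proof -
      have "0 < 1 / q i" using q0[OF that(1)] by simp
      then have "- (q i + 1 / q i) \<le> g i y - q i" using g0[OF that] by linarith
      then show ?thesis unfolding minus_divide_left using lnb by (intro divide_right_mono) auto
    qed
    also have "\<dots> \<le> f i y" by (rule f_lower[OF that])
    finally show ?thesis using 1 by simp
  qed
  have f_int: "integrable T' (f i)" if "i \<in> S" for i
    using f_bound[OF that] that by (intro T'.integrable_const_bound[where B="(q i + 1 / q i) / ln b"]) (auto simp: space_T')
  have joint_int: "integrable (count_space S \<Otimes>\<^sub>M T') (\<lambda>x. Pxy x * log b (Pxy x / (q (fst x) * 1)))"
  proof -
    have "integrable (count_space S \<Otimes>\<^sub>M T') (case_prod f)"
    proof (rule ST.Fubini_integrable)
      show "case_prod f \<in> borel_measurable (count_space S \<Otimes>\<^sub>M T')"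
        using S by (intro measurable_pair_measure_countable1) (auto intro: countable_finite)
    qed (use S f_int in \<open>auto intro!: integrable_count_space\<close>)
    then show ?thesis by (simp add: f_def Pxy_def split_def)
  qed
  have sf: "sigma_finite_measure (count_space S)" "sigma_finite_measure T'" ..
  have "mutual_information b (count_space S) T X Y = mutual_information b (count_space S) T' X Y"
    unfolding mutual_information_def
    by (intro arg_cong2[where f="KL_divergence b"] arg_cong2[where f="(\<Otimes>\<^sub>M)"] distr_cong refl sets_pair_measure_cong)
       (simp_all add: sets_T')
  also have "\<dots> = (\<integral>x. Pxy x * log b (Pxy x / (q (fst x) * 1)) \<partial>(count_space S \<Otimes>\<^sub>M T'))"
    using sf Px Py Pxy q0 g0 by (intro mutual_information_distr) (auto simp: Pxy_def space_T' less_imp_le)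
  also have "\<dots> = (\<Sum>i\<in>S. \<integral>y. f i y \<partial>T')"
    using ST.integral_fst[of f] joint_int S
    by (simp add: f_def Pxy_def split_def lebesgue_integral_count_space_finite)
  finally have MI: "mutual_information b (count_space S) T X Y = (\<Sum>i\<in>S. \<integral>y. f i y \<partial>T')" .
  have g_int: "integrable T' (g i)" if "i \<in> S" for i
    using g0[OF that] g1[OF that] that by (intro T'.integrable_const_bound[where B=1]) (auto simp: space_T')
  have g2_int: "integrable T' (\<lambda>y. (g i y)\<^sup>2)" if "i \<in> S" for i
    using g0[OF that] g1[OF that] that
    by (intro T'.integrable_const_bound[where B=1]) (auto simp: space_T' abs_square_le_1)
  have Eg': "(\<integral>y. g i y \<partial>T') = q i" if "i \<in> S" for i
    unfolding T'_def using Eg[OF that] g[OF that] by (subst integral_distr) auto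
  \<comment> \<open>The posterior has mean \<open>q i\<close>, so the lower bound
    \<open>f_lower\<close> integrates to 0.\<close>
  have "0 = (\<Sum>i\<in>S. \<integral>y. (g i y - q i) / ln b \<partial>T')"
    using g_int by (simp add: Eg' T'.prob_space)
  also have "\<dots> \<le> (\<Sum>i\<in>S. \<integral>y. f i y \<partial>T')"
    using g_int f_int f_lower by (intro sum_mono integral_mono) (auto simp: space_T')
  finally show "0 \<le> mutual_information b (count_space S) T X Y" by (simp add: MI)
  have "(\<Sum>i\<in>S. \<integral>y. f i y \<partial>T') \<le> (\<Sum>i\<in>S. \<integral>y. (g i y * (g i y / q i - 1)) / ln b \<partial>T')"
    using g_int g2_int f_int f_upper
    by (intro sum_mono integral_mono) (auto simp: space_T' algebra_simps power2_eq_square)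
  also have "\<dots> = (\<Sum>i\<in>S. \<integral>y. (g i y - q i)\<^sup>2 / q i / ln b \<partial>T')"
  \<comment> \<open>The integrands differ by (q i - g i y) / ln b, which has mean 0.\<close>
  proof (intro sum.cong refl)
    fix i assume i: "i \<in> S"
    have "(\<integral>y. (g i y - q i)\<^sup>2 / q i / ln b \<partial>T') = (\<integral>y. (g i y * (g i y / q i - 1)) / ln b + (q i - g i y) / ln b \<partial>T')"
      using q0[OF i] lnb by (intro Bochner_Integration.integral_cong) (auto simp: field_simps power2_eq_square)
    also have "\<dots> = (\<integral>y. (g i y * (g i y / q i - 1)) / ln b \<partial>T') + (\<integral>y. (q i - g i y) / ln b \<partial>T')"
      using g_int[OF i] g2_int[OF i]
      by (intro Bochner_Integration.integral_add) (auto simp: algebra_simps power2_eq_square)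
    also have "(\<integral>y. (q i - g i y) / ln b \<partial>T') = 0"
      using g_int[OF i] by (simp add: Eg'[OF i] T'.prob_space)
    finally show "(\<integral>y. (g i y * (g i y / q i - 1)) / ln b \<partial>T') = (\<integral>y. (g i y - q i)\<^sup>2 / q i / ln b \<partial>T')"
      by simp
  qed
  also have "\<dots> = (\<Sum>i\<in>S. expectation (\<lambda>\<omega>. (g i (Y \<omega>) - q i)\<^sup>2) / q i) / ln b"
    unfolding T'_def sum_divide_distrib using g by (intro sum.cong refl) (simp add: integral_distr)
  finally show "mutual_information b (count_space S) T X Y \<le> (\<Sum>i\<in>S. expectation (\<lambda>\<omega>. (g i (Y \<omega>) - q i)\<^sup>2) / q i) / ln b"
    by (simp add: MI)
qed

section \<open>The location model\<close>

text \<open>Independence passes to the smaller sigma-algebras generated by two real variables, where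
  it becomes factorization of the mean. It serves to split off the event that the permutation takes
  a given value.\<close>

lemma (in prob_space) indep_set_integral_indicator_mult:
  fixes Z :: "'a \<Rightarrow> real"
  assumes indep: "indep_set (sets A) (sets G)"
    and A: "space A = space M" "E \<in> sets A"
    and G: "space G = space M" and Z: "Z \<in> borel_measurable G" and int: "integrable M Z"
  shows "expectation (\<lambda>\<omega>. indicator E \<omega> * Z \<omega>) = prob E * expectation Z"
proof -
  have sub: "sets A \<subseteq> events" "sets G \<subseteq> events"
    using indep_setD_ev1[OF indep] indep_setD_ev2[OF indep] by auto
  have E: "E \<in> events" using A sub by auto
  have ZM: "Z \<in> borel_measurable M"
    using measurable_sets[OF Z] G sub by (auto simp: measurable_def)
  have iA: "(indicator E :: 'a \<Rightarrow> real) \<in> borel_measurable A"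
    using A by (intro borel_measurable_indicator) auto
  have "indep_var borel (indicator E :: 'a \<Rightarrow> real) borel Z"
    unfolding indep_var_eq
  proof (intro conjI)
    have "sigma_sets (space A) {indicator E -` B \<inter> space A |B. B \<in> sets (borel :: real measure)} \<subseteq> sets A"
      using measurable_sets[OF iA] by (intro sets.sigma_sets_subset) auto
    moreover have "sigma_sets (space G) {Z -` B \<inter> space G |B. B \<in> sets borel} \<subseteq> sets G"
      using measurable_sets[OF Z] by (intro sets.sigma_sets_subset) auto
    ultimately have "indep_sets (case_bool (sigma_sets (space M) {indicator E -` B \<inter> space M |B. B \<in> sets (borel :: real measure)})
            (sigma_sets (space M) {Z -` B \<inter> space M |B. B \<in> sets borel})) UNIV"
      unfolding A(1) G by (intro indep_sets_mono_sets[OF indep[unfolded indep_set_def]]) (auto split: bool.split)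
    then show "indep_set (sigma_sets (space M) {indicator E -` B \<inter> space M |B. B \<in> sets (borel :: real measure)})
            (sigma_sets (space M) {Z -` B \<inter> space M |B. B \<in> sets borel})"
      unfolding indep_set_def .
  qed (use E ZM in auto)
  then have "expectation (\<lambda>\<omega>. indicator E \<omega> * Z \<omega>) = expectation (indicator E) * expectation Z"
    using E int by (intro indep_var_lebesgue_integral) (auto simp: less_top[symmetric])
  then show ?thesis using E by simp
qed

text \<open>The joint law of the parameters is left open here: the bounds in this locale are
  expressed through the number of users near user 1, and density and independence of the parameters
  are used only to estimate that number.\<close>

locale anonymized_locations = prob_space M for M :: "'a measure" +
  fixes r :: nat and p :: "nat \<Rightarrow> 'a \<Rightarrow> nat \<Rightarrow> real" and X :: "nat \<Rightarrow> nat \<Rightarrow> 'a \<Rightarrow> nat"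
    and Perm :: "nat \<Rightarrow> 'a \<Rightarrow> nat \<Rightarrow> nat"
  assumes p_rv: "\<And>u. u \<ge> 1 \<Longrightarrow> p u \<in> measurable M (vec_space r)"
    and p_prob: "\<And>u \<omega>. u \<ge> 1 \<Longrightarrow> \<omega> \<in> space M \<Longrightarrow> prob_vector r (p u \<omega>)"
    and X_rv: "\<And>u t. u \<ge> 1 \<Longrightarrow> t \<ge> 1 \<Longrightarrow> X u t \<in> measurable M (count_space {..<r})"
    and X_law: "\<And>u t i. u \<ge> 1 \<Longrightarrow> t \<ge> 1 \<Longrightarrow> i < r \<Longrightarrow>
          AE \<omega> in M. cond_prob_sigma M (params_sigma M r p) {\<omega> \<in> space M. X u t \<omega> = i} \<omega> = p u \<omega> i"
    and X_indep: "cond_indep_discrete M (params_sigma M r p) (\<lambda>(u, t). X u t) ({1..} \<times> {1..})"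
    and Perm_rv: "\<And>n. n \<ge> 1 \<Longrightarrow> Perm n \<in> measurable M (count_space (permutations_upto n))"
    and Perm_unif: "\<And>n. n \<ge> 1 \<Longrightarrow>
          distr M (count_space (permutations_upto n)) (Perm n) =
            uniform_count_measure (permutations_upto n)"
    and Perm_indep: "\<And>n. n \<ge> 1 \<Longrightarrow>
          prob_space.indep_set M
            (sets (vimage_algebra (space M) (Perm n) (count_space (permutations_upto n))))
            (sets (params_locations_sigma M r p X))"
begin

abbreviation "params \<equiv> params_sigma M r p"

lemma params_measurable: "(\<lambda>\<omega>. \<lambda>u\<in>{1..}. p u \<omega>) \<in> measurable M (PiM {1..} (\<lambda>_. vec_space r))"
  using p_rv by (intro measurable_restrict) auto

lemma locations_measurable:
  "(\<lambda>\<omega>. \<lambda>(u, t)\<in>{1..} \<times> {1..}. X u t \<omega>) \<in> measurable M (PiM ({1..} \<times> {1..}) (\<lambda>_. count_space {..<r}))"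
proof -
  have "(\<lambda>\<omega>. \<lambda>c\<in>{1..} \<times> {1..}. X (fst c) (snd c) \<omega>) \<in> measurable M (PiM ({1..} \<times> {1..}) (\<lambda>_. count_space {..<r}))"
    using X_rv by (intro measurable_restrict) auto
  then show ?thesis by (simp add: split_def)
qed

lemma space_params [simp]: "space params = space M"
  by (simp add: params_sigma_def)

lemma subalgebra_params: "subalgebra M params"
  unfolding subalgebra_def params_sigma_def
  using sets_image_in_sets[OF refl params_measurable] by simp

sublocale params: finite_measure_subalgebra M params
  by standard (rule subalgebra_params)

lemma params_measurable_params:
  "(\<lambda>\<omega>. \<lambda>u\<in>{1..}. p u \<omega>) \<in> measurable params (PiM {1..} (\<lambda>_. vec_space r))"
  unfolding params_sigma_def using measurable_space[OF params_measurable]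
  by (intro measurable_vimage_algebra1) auto

lemma p_measurable_params: "u \<ge> 1 \<Longrightarrow> p u \<in> measurable params (vec_space r)"
  using measurable_compose[OF params_measurable_params measurable_component_singleton[of u "{1..}" "\<lambda>_. vec_space r"]]
  by simp

lemma p_component_measurable_params: "u \<ge> 1 \<Longrightarrow> i < r \<Longrightarrow> (\<lambda>\<omega>. p u \<omega> i) \<in> borel_measurable params"
  using measurable_compose[OF p_measurable_params[unfolded vec_space_def] measurable_component_singleton[of i "{..<r}" "\<lambda>_. borel"]]
  by simp

lemma measurable_params_M: "f \<in> measurable params N \<Longrightarrow> f \<in> measurable M N"
  using measurable_from_subalg[OF subalgebra_params] .

definition "joint_sigma = params_locations_sigma M r p X"

lemma space_joint_sigma [simp]: "space joint_sigma = space M"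
  by (simp add: joint_sigma_def params_locations_sigma_def)

lemma joint_measurable_joint_sigma:
  "(\<lambda>\<omega>. (\<lambda>u\<in>{1..}. p u \<omega>, \<lambda>(u, t)\<in>{1..} \<times> {1..}. X u t \<omega>))
     \<in> measurable joint_sigma (PiM {1..} (\<lambda>_. vec_space r) \<Otimes>\<^sub>M PiM ({1..} \<times> {1..}) (\<lambda>_. count_space {..<r}))"
  unfolding joint_sigma_def params_locations_sigma_def
  using measurable_space[OF params_measurable] measurable_space[OF locations_measurable]
  by (intro measurable_vimage_algebra1) (auto simp: space_pair_measure)

lemma measurable_params_joint_sigma:
  assumes "f \<in> measurable params N"
  shows "f \<in> measurable joint_sigma N"
proof -
  have "sets params \<subseteq> sets joint_sigma"
    unfolding params_sigma_def
    using measurable_compose[OF joint_measurable_joint_sigma measurable_fst]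
    by (intro sets_image_in_sets) auto
  then have "subalgebra joint_sigma params" by (simp add: subalgebra_def)
  then show ?thesis using assms measurable_from_subalg by blast
qed

lemma X_measurable_joint_sigma:
  assumes "u \<ge> 1" "t \<ge> 1"
  shows "X u t \<in> measurable joint_sigma (count_space {..<r})"
  using measurable_compose[OF measurable_compose[OF joint_measurable_joint_sigma measurable_snd]
      measurable_component_singleton[of "(u, t)" "{1..} \<times> {1..}" "\<lambda>_. count_space {..<r}"]] assms
  by simp

definition locations_event :: "(nat \<times> nat) set \<Rightarrow> (nat \<times> nat \<Rightarrow> nat) \<Rightarrow> 'a set" where
  "locations_event D x = {\<omega> \<in> space M. \<forall>c\<in>D. X (fst c) (snd c) \<omega> = x c}"

lemma locations_event_joint_sigma:
  assumes "finite D" "D \<subseteq> {1..} \<times> {1..}" "x \<in> D \<rightarrow>\<^sub>E {..<r}"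
  shows "locations_event D x \<in> sets joint_sigma"
proof -
  have "{\<omega> \<in> space joint_sigma. X (fst c) (snd c) \<omega> = x c} \<in> sets joint_sigma" if "c \<in> D" for c
  proof -
    have "X (fst c) (snd c) -` {x c} \<inter> space joint_sigma \<in> sets joint_sigma"
      using that assms by (intro measurable_sets[OF X_measurable_joint_sigma]) auto
    then show ?thesis by (simp add: vimage_def Int_def conj_commute)
  qed
  then show ?thesis
    unfolding locations_event_def space_joint_sigma[symmetric] using assms(1)
    by (intro sets.sets_Collect_finite_All) auto
qed

lemma joint_sigma_sub_M: "sets joint_sigma \<subseteq> sets M"
  unfolding joint_sigma_def params_locations_sigma_def
  using params_measurable locations_measurable by (intro sets_image_in_sets) auto

lemma locations_event_M:
  assumes "finite D" "D \<subseteq> {1..} \<times> {1..}" "x \<in> D \<rightarrow>\<^sub>E {..<r}"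
  shows "locations_event D x \<in> sets M"
  using locations_event_joint_sigma[OF assms] joint_sigma_sub_M by auto

text \<open>Conditional independence factors the event, and \<open>X_law\<close> evaluates each
  factor; \<open>D\<close> is finite, so the exceptional null sets can be collected.\<close>

lemma cond_prob_locations_event:
  assumes D: "finite D" "D \<subseteq> {1..} \<times> {1..}" "x \<in> D \<rightarrow>\<^sub>E {..<r}"
  shows "AE \<omega> in M. real_cond_exp M params (indicator (locations_event D x)) \<omega> = locations_pmf (\<lambda>u. p u \<omega>) D x"
proof -
  have "AE \<omega> in M. \<forall>c\<in>D. cond_prob_sigma M params {\<omega> \<in> space M. X (fst c) (snd c) \<omega> = x c} \<omega> = p (fst c) \<omega> (x c)"
    using D by (intro AE_finite_allI X_law) auto
  moreover have "AE \<omega> in M. cond_prob_sigma M params (locations_event D x) \<omega>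
      = (\<Prod>c\<in>D. cond_prob_sigma M params {\<omega> \<in> space M. X (fst c) (snd c) \<omega> = x c} \<omega>)"
    using X_indep D(1,2) unfolding cond_indep_discrete_def locations_event_def by (simp add: split_def)
  ultimately show ?thesis
    by eventually_elim (simp add: cond_prob_sigma_def locations_pmf_def)
qed

lemma expectation_locations_event:
  assumes D: "finite D" "D \<subseteq> {1..} \<times> {1..}" "x \<in> D \<rightarrow>\<^sub>E {..<r}"
    and h: "h \<in> borel_measurable params" "\<And>\<omega>. \<omega> \<in> space M \<Longrightarrow> \<bar>h \<omega>\<bar> \<le> C"
  shows "integrable M (\<lambda>\<omega>. h \<omega> * indicator (locations_event D x) \<omega>)"
    and "expectation (\<lambda>\<omega>. h \<omega> * indicator (locations_event D x) \<omega>) = expectation (\<lambda>\<omega>. h \<omega> * locations_pmf (\<lambda>u. p u \<omega>) D x)"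
proof -
  have [measurable]: "locations_event D x \<in> sets M" "h \<in> borel_measurable M"
    using locations_event_M[OF D] measurable_params_M[OF h(1)] by auto
  have "\<bar>h \<omega> * indicator (locations_event D x) \<omega>\<bar> \<le> max C 0" if "\<omega> \<in> space M" for \<omega>
    using h(2)[OF that] by (auto simp: indicator_def)
  then show int: "integrable M (\<lambda>\<omega>. h \<omega> * indicator (locations_event D x) \<omega>)"
    by (intro integrable_const_bound[where B="max C 0"]) auto
  have [measurable]: "(\<lambda>\<omega>. locations_pmf (\<lambda>u. p u \<omega>) D x) \<in> borel_measurable M"
    unfolding locations_pmf_def using D
    by (intro borel_measurable_prod measurable_params_M p_component_measurable_params) auto
  have "expectation (\<lambda>\<omega>. h \<omega> * indicator (locations_event D x) \<omega>)
      = expectation (\<lambda>\<omega>. h \<omega> * real_cond_exp M params (indicator (locations_event D x)) \<omega>)"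
    using params.real_cond_exp_intg(2)[OF int h(1)] by simp
  also have "\<dots> = expectation (\<lambda>\<omega>. h \<omega> * locations_pmf (\<lambda>u. p u \<omega>) D x)"
    using cond_prob_locations_event[OF D] by (intro integral_cong_AE) (auto elim!: eventually_mono)
  finally show "expectation (\<lambda>\<omega>. h \<omega> * indicator (locations_event D x) \<omega>) = expectation (\<lambda>\<omega>. h \<omega> * locations_pmf (\<lambda>u. p u \<omega>) D x)" .
qed

lemma prob_Perm:
  assumes n: "n \<ge> 1" and \<pi>: "\<pi> \<in> permutations_upto n"
  shows "prob {\<omega> \<in> space M. Perm n \<omega> = \<pi>} = 1 / fact n"
proof -
  have "prob {\<omega> \<in> space M. Perm n \<omega> = \<pi>} = measure (distr M (count_space (permutations_upto n)) (Perm n)) {\<pi>}"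
    using \<pi> Perm_rv[OF n] by (subst measure_distr) (auto simp: vimage_def Int_def conj_commute)
  also have "\<dots> = 1 / fact n"
    using \<pi> unfolding Perm_unif[OF n]
    by (subst measure_uniform_count_measure) auto
  finally show ?thesis .
qed

text \<open>The permutation and the array take finitely many values, so everything random except the
  parameters can be summed out. What remains under the expectation is, for each outcome, a finite
  sum to which the swap inequality applies.\<close>

lemma expectation_Perm_locations:
  fixes \<Phi> :: "(nat \<Rightarrow> nat) \<Rightarrow> (nat \<times> nat \<Rightarrow> nat) \<Rightarrow> 'a \<Rightarrow> real"
  assumes n: "n \<ge> 1" and D: "finite D" "D \<subseteq> {1..} \<times> {1..}"
    and \<Phi>: "\<And>\<pi> x. \<pi> \<in> permutations_upto n \<Longrightarrow> x \<in> D \<rightarrow>\<^sub>E {..<r} \<Longrightarrow> \<Phi> \<pi> x \<in> borel_measurable params"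
    and C: "\<And>\<pi> x \<omega>. \<pi> \<in> permutations_upto n \<Longrightarrow> x \<in> D \<rightarrow>\<^sub>E {..<r} \<Longrightarrow> \<omega> \<in> space M \<Longrightarrow> \<bar>\<Phi> \<pi> x \<omega>\<bar> \<le> C"
  shows "expectation (\<lambda>\<omega>. \<Phi> (Perm n \<omega>) (\<lambda>c\<in>D. X (fst c) (snd c) \<omega>) \<omega>)
    = expectation (\<lambda>\<omega>. (\<Sum>\<pi>\<in>permutations_upto n. \<Sum>x\<in>D \<rightarrow>\<^sub>E {..<r}. locations_pmf (\<lambda>u. p u \<omega>) D x * \<Phi> \<pi> x \<omega>) / fact n)"
proof -
  define Q where "Q = permutations_upto n"
  define S where "S = (D \<rightarrow>\<^sub>E {..<r})"
  define E where "E \<pi> = {\<omega> \<in> space M. Perm n \<omega> = \<pi>}" for \<pi>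
  have fin: "finite Q" "finite S" using D by (auto simp: Q_def S_def intro!: finite_PiE)
  have E_sets: "E \<pi> \<in> sets (vimage_algebra (space M) (Perm n) (count_space (permutations_upto n)))" if "\<pi> \<in> Q" for \<pi>
    using in_vimage_algebra[of "{\<pi>}" "count_space (permutations_upto n)" "Perm n" "space M"] that
    by (simp add: E_def Q_def vimage_def Int_def conj_commute)
  have E_M: "E \<pi> \<in> sets M" if "\<pi> \<in> Q" for \<pi>
    using E_sets[OF that] indep_setD_ev1[OF Perm_indep[OF n]] by auto
  have XS: "(\<lambda>c\<in>D. X (fst c) (snd c) \<omega>) \<in> S" if "\<omega> \<in> space M" for \<omega>
    using D measurable_space[OF X_rv that] by (auto simp: S_def subset_iff)
  have PQ: "Perm n \<omega> \<in> Q" if "\<omega> \<in> space M" for \<omega>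
    using measurable_space[OF Perm_rv[OF n] that] by (simp add: Q_def)
  have ev: "\<omega> \<in> locations_event D x \<longleftrightarrow> x = (\<lambda>c\<in>D. X (fst c) (snd c) \<omega>)" if "\<omega> \<in> space M" "x \<in> S" for \<omega> x
    using that by (auto simp: locations_event_def S_def PiE_iff extensional_def fun_eq_iff)
  have one: "integrable M (\<lambda>\<omega>. indicator (E \<pi>) \<omega> * (\<Phi> \<pi> x \<omega> * indicator (locations_event D x) \<omega>))" (is "integrable M ?I")
     "expectation (\<lambda>\<omega>. indicator (E \<pi>) \<omega> * (\<Phi> \<pi> x \<omega> * indicator (locations_event D x) \<omega>))
      = expectation (\<lambda>\<omega>. locations_pmf (\<lambda>u. p u \<omega>) D x * \<Phi> \<pi> x \<omega> / fact n)"
     if \<pi>: "\<pi> \<in> Q" and x: "x \<in> S" for \<pi> x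
  proof -
    have x': "x \<in> D \<rightarrow>\<^sub>E {..<r}" using x by (simp add: S_def)
    have \<Phi>': "\<Phi> \<pi> x \<in> borel_measurable params" "\<And>\<omega>. \<omega> \<in> space M \<Longrightarrow> \<bar>\<Phi> \<pi> x \<omega>\<bar> \<le> C"
      using \<Phi> C \<pi> x by (auto simp: Q_def S_def)
    note ex = expectation_locations_event[OF D x' \<Phi>']
    show "integrable M ?I"
      using integrable_mult_indicator[OF E_M[OF \<pi>] ex(1)] by simp
    \<comment> \<open>This uses independence of the permutation from parameters and locations
      jointly.\<close>
    have "expectation ?I = prob (E \<pi>) * expectation (\<lambda>\<omega>. \<Phi> \<pi> x \<omega> * indicator (locations_event D x) \<omega>)"
    proof (rule indep_set_integral_indicator_mult[OF Perm_indep[OF n]])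
      show "(\<lambda>\<omega>. \<Phi> \<pi> x \<omega> * indicator (locations_event D x) \<omega>) \<in> borel_measurable (params_locations_sigma M r p X)"
        using measurable_params_joint_sigma[OF \<Phi>'(1)] locations_event_joint_sigma[OF D x']
        unfolding joint_sigma_def by (intro borel_measurable_times borel_measurable_indicator)
      show "space (params_locations_sigma M r p X) = space M"
        using space_joint_sigma by (simp add: joint_sigma_def)
    qed (use E_sets[OF \<pi>] ex(1) in auto)
    also have "prob (E \<pi>) = 1 / fact n"
      using \<pi> prob_Perm[OF n] by (simp add: E_def Q_def)
    finally show "expectation ?I = expectation (\<lambda>\<omega>. locations_pmf (\<lambda>u. p u \<omega>) D x * \<Phi> \<pi> x \<omega> / fact n)"
      by (simp add: ex(2) mult.commute)
  qed
  have pm_int: "integrable M (\<lambda>\<omega>. locations_pmf (\<lambda>u. p u \<omega>) D x * \<Phi> \<pi> x \<omega> / fact n)" if "\<pi> \<in> Q" "x \<in> S" for \<pi> x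
  proof -
    have m: "(\<lambda>\<omega>. locations_pmf (\<lambda>u. p u \<omega>) D x) \<in> borel_measurable M" "\<Phi> \<pi> x \<in> borel_measurable M"
      unfolding locations_pmf_def using D that \<Phi>
      by (auto intro!: borel_measurable_prod measurable_params_M p_component_measurable_params simp: S_def Q_def PiE_iff)
    have "\<bar>locations_pmf (\<lambda>u. p u \<omega>) D x\<bar> \<le> 1" if w: "\<omega> \<in> space M" for \<omega>
    proof -
      have "0 \<le> p (fst c) \<omega> (x c) \<and> p (fst c) \<omega> (x c) \<le> 1" if c: "c \<in> D" for c
      proof -
        have "fst c \<ge> 1" "x c < r" using c D \<open>x \<in> S\<close> by (auto simp: S_def)
        then show ?thesis
          using p_prob[of "fst c" \<omega>] w member_le_sum[of "x c" "{..<r}" "p (fst c) \<omega>"]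
          by (auto simp: prob_vector_def)
      qed
      then show ?thesis
        unfolding locations_pmf_def abs_prod by (intro prod_le_1) auto
    qed
    moreover have "\<bar>\<Phi> \<pi> x \<omega>\<bar> \<le> C" if "\<omega> \<in> space M" for \<omega>
      using C[of \<pi> x \<omega>] that \<open>\<pi> \<in> Q\<close> \<open>x \<in> S\<close> by (simp add: Q_def S_def)
    ultimately have "\<bar>locations_pmf (\<lambda>u. p u \<omega>) D x * \<Phi> \<pi> x \<omega>\<bar> \<le> 1 * C" if "\<omega> \<in> space M" for \<omega>
      unfolding abs_mult using that by (intro mult_mono) simp_all
    then have "integrable M (\<lambda>\<omega>. locations_pmf (\<lambda>u. p u \<omega>) D x * \<Phi> \<pi> x \<omega>)"
      using m by (intro integrable_const_bound[where B="1 * C"]) auto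
    then show ?thesis by (rule integrable_divide)
  qed
  have "expectation (\<lambda>\<omega>. \<Phi> (Perm n \<omega>) (\<lambda>c\<in>D. X (fst c) (snd c) \<omega>) \<omega>)
      = expectation (\<lambda>\<omega>. \<Sum>\<pi>\<in>Q. \<Sum>x\<in>S. indicator (E \<pi>) \<omega> * (\<Phi> \<pi> x \<omega> * indicator (locations_event D x) \<omega>))"
  proof (intro Bochner_Integration.integral_cong refl)
    fix \<omega> assume w: "\<omega> \<in> space M"
    \<comment> \<open>Exactly one pair, the actual permutation and the actual array, makes both
      indicators 1.\<close>
    have "(\<Sum>\<pi>\<in>Q. \<Sum>x\<in>S. indicator (E \<pi>) \<omega> * (\<Phi> \<pi> x \<omega> * indicator (locations_event D x) \<omega>))
        = (\<Sum>\<pi>\<in>Q. \<Sum>x\<in>S. if x = (\<lambda>c\<in>D. X (fst c) (snd c) \<omega>) then (if \<pi> = Perm n \<omega> then \<Phi> \<pi> x \<omega> else 0) else 0)"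
      using w ev[OF w] by (intro sum.cong refl) (auto simp: E_def indicator_def)
    also have "\<dots> = \<Phi> (Perm n \<omega>) (\<lambda>c\<in>D. X (fst c) (snd c) \<omega>) \<omega>"
      using fin XS[OF w] PQ[OF w] by simp
    finally show "\<Phi> (Perm n \<omega>) (\<lambda>c\<in>D. X (fst c) (snd c) \<omega>) \<omega>
      = (\<Sum>\<pi>\<in>Q. \<Sum>x\<in>S. indicator (E \<pi>) \<omega> * (\<Phi> \<pi> x \<omega> * indicator (locations_event D x) \<omega>))" by simp
  qed
  also have "\<dots> = (\<Sum>\<pi>\<in>Q. \<Sum>x\<in>S. expectation (\<lambda>\<omega>. locations_pmf (\<lambda>u. p u \<omega>) D x * \<Phi> \<pi> x \<omega> / fact n))"
    using one by (simp add: Bochner_Integration.integral_sum Bochner_Integration.integrable_sum)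
  also have "\<dots> = expectation (\<lambda>\<omega>. \<Sum>\<pi>\<in>Q. \<Sum>x\<in>S. locations_pmf (\<lambda>u. p u \<omega>) D x * \<Phi> \<pi> x \<omega> / fact n)"
    using pm_int by (simp add: Bochner_Integration.integral_sum Bochner_Integration.integrable_sum
      del: integral_divide_zero integral_mult_left_zero integral_mult_right_zero)
  finally show ?thesis
    by (simp add: Q_def S_def sum_divide_distrib)
qed

end

section \<open>Posterior probabilities\<close>

text \<open>\<open>g\<close> is the Radon-Nikodym derivative of the law of \<open>Y\<close>
  restricted to \<open>E\<close> with respect to the law of \<open>Y\<close>. This makes it a
  function of the observed value rather than of the outcome, as the swap argument requires.\<close>

lemma (in prob_space) posterior_exists:
  assumes Y [measurable]: "Y \<in> measurable M T" and E [measurable]: "E \<in> events"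
  obtains g :: "'b \<Rightarrow> real" where "g \<in> borel_measurable T" "\<And>y. 0 \<le> g y" "\<And>y. g y \<le> 1"
    "\<And>A. A \<in> sets T \<Longrightarrow> emeasure M {\<omega> \<in> space M. \<omega> \<in> E \<and> Y \<omega> \<in> A} = (\<integral>\<^sup>+\<omega>. ennreal (g (Y \<omega>)) * indicator A (Y \<omega>) \<partial>M)"
    "\<And>h. h \<in> borel_measurable T \<Longrightarrow> expectation (\<lambda>\<omega>. indicator E \<omega> * h (Y \<omega>)) = expectation (\<lambda>\<omega>. g (Y \<omega>) * (h (Y \<omega>) :: real))"
proof -
  define \<mu> where "\<mu> = distr M T Y"
  define \<nu> where "\<nu> = distr (density M (\<lambda>\<omega>. ennreal (indicator E \<omega>))) T Y"
  have sets_eq [measurable_cong]: "sets \<mu> = sets T" "sets \<nu> = sets T" by (simp_all add: \<mu>_def \<nu>_def)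
  interpret \<mu>: prob_space \<mu> unfolding \<mu>_def by (rule prob_space_distr) fact
  have \<nu>: "emeasure \<nu> A = emeasure M {\<omega> \<in> space M. \<omega> \<in> E \<and> Y \<omega> \<in> A}" if [measurable]: "A \<in> sets T" for A
  proof -
    have "emeasure \<nu> A = (\<integral>\<^sup>+\<omega>. ennreal (indicator E \<omega>) * indicator (Y -` A \<inter> space M) \<omega> \<partial>M)"
      unfolding \<nu>_def by (simp add: emeasure_distr emeasure_density del: ennreal_indicator)
    also have "\<dots> = (\<integral>\<^sup>+\<omega>. indicator {\<omega> \<in> space M. \<omega> \<in> E \<and> Y \<omega> \<in> A} \<omega> \<partial>M)"
      by (intro nn_integral_cong) (auto simp: indicator_def)
    finally show ?thesis by simp
  qed
  have le: "emeasure \<nu> A \<le> emeasure \<mu> A" if [measurable]: "A \<in> sets T" for A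
    unfolding \<nu>[OF that] \<mu>_def by (subst emeasure_distr) (auto intro!: emeasure_mono)
  define d where "d = RN_deriv \<mu> \<nu>"
  have [measurable]: "d \<in> borel_measurable T"
    using borel_measurable_RN_deriv[of \<mu> \<nu>] by (simp add: d_def cong: measurable_cong_sets)
  have dens: "density \<mu> d = \<nu>"
    unfolding d_def
  proof (rule \<mu>.density_RN_deriv)
    show "absolutely_continuous \<mu> \<nu>"
      unfolding absolutely_continuous_def null_sets_def using le by (auto simp: sets_eq) (metis le_zero_eq)
  qed (simp add: sets_eq)
  \<comment> \<open>On the set where \<open>d\<close> exceeds 1 the excess integrates to at most 0,
    since \<open>\<nu>\<close> is dominated by \<open>\<mu>\<close>; finiteness of
    \<open>\<mu>\<close> permits the cancellation.\<close>
  have "AE y in \<mu>. d y \<le> 1"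
  proof -
    define A where "A = {y \<in> space T. 1 < d y}"
    have [measurable]: "A \<in> sets T" by (simp add: A_def)
    have "(\<integral>\<^sup>+y. (d y - 1) * indicator A y \<partial>\<mu>) + emeasure \<mu> A = (\<integral>\<^sup>+y. (d y - 1) * indicator A y + indicator A y \<partial>\<mu>)"
      by (simp add: nn_integral_add)
    also have "\<dots> = (\<integral>\<^sup>+y. d y * indicator A y \<partial>\<mu>)"
      by (intro nn_integral_cong) (auto simp: A_def indicator_def diff_add_cancel_ennreal)
    also have "\<dots> = emeasure \<nu> A"
      by (simp add: emeasure_density flip: dens)
    also have "\<dots> \<le> 0 + emeasure \<mu> A" using le by simp
    finally have "emeasure \<mu> A + (\<integral>\<^sup>+y. (d y - 1) * indicator A y \<partial>\<mu>) \<le> emeasure \<mu> A + 0"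
      by (simp only: add.commute)
    then have "(\<integral>\<^sup>+y. (d y - 1) * indicator A y \<partial>\<mu>) \<le> 0"
      using \<mu>.emeasure_finite[of A] unfolding ennreal_add_left_cancel_le by simp
    then have "(\<integral>\<^sup>+y. (d y - 1) * indicator A y \<partial>\<mu>) = 0" by simp
    then have "AE y in \<mu>. (d y - 1) * indicator A y = 0"
      by (subst (asm) nn_integral_0_iff_AE) auto
    with AE_space[of \<mu>] show ?thesis
      by eventually_elim
         (auto simp: A_def sets_eq_imp_space_eq[OF sets_eq(1)] indicator_def diff_eq_0_iff_ennreal not_less split: if_splits)
  qed
  \<comment> \<open>Truncation changes \<open>d\<close> on a null set only and gives bounds at every
    point.\<close>
  define g where "g y = enn2real (min 1 (d y))" for y
  have g_meas [measurable]: "g \<in> borel_measurable T" unfolding g_def[abs_def] by measurable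
  have g0: "0 \<le> g y" for y by (simp add: g_def)
  have min_fin: "min 1 (d y) < top" for y by (simp add: min_less_iff_disj)
  have g1: "g y \<le> 1" for y
    unfolding g_def using enn2real_mono[of "min 1 (d y)" 1] by simp
  have dg: "density \<mu> (\<lambda>y. ennreal (g y)) = \<nu>"
    unfolding dens[symmetric]
  proof (rule density_cong)
    show "AE y in \<mu>. ennreal (g y) = d y"
      using \<open>AE y in \<mu>. d y \<le> 1\<close> 
    proof eventually_elim
      case (elim y)
      then show ?case
        unfolding g_def ennreal_enn2real[OF min_fin] by (rule min_absorb2)
    qed
  qed auto
  show ?thesis
  proof (rule that[OF g_meas g0 g1])
    fix A assume [measurable]: "A \<in> sets T"
    have "emeasure \<nu> A = (\<integral>\<^sup>+y. ennreal (g y) * indicator A y \<partial>\<mu>)"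
      unfolding dg[symmetric] by (rule emeasure_density) auto
    then show "emeasure M {\<omega> \<in> space M. \<omega> \<in> E \<and> Y \<omega> \<in> A} = (\<integral>\<^sup>+\<omega>. ennreal (g (Y \<omega>)) * indicator A (Y \<omega>) \<partial>M)"
      unfolding \<mu>_def by (subst (asm) nn_integral_distr) (auto simp: \<nu>)
  next
    fix h :: "'b \<Rightarrow> real" assume [measurable]: "h \<in> borel_measurable T"
    have "expectation (\<lambda>\<omega>. indicator E \<omega> * h (Y \<omega>)) = (\<integral>y. h y \<partial>\<nu>)"
      unfolding \<nu>_def
      by (subst integral_distr, measurable) (subst integral_real_density, auto)
    also have "\<dots> = (\<integral>y. g y * h y \<partial>\<mu>)"
      unfolding dg[symmetric] using g0 by (subst integral_real_density) auto
    also have "\<dots> = expectation (\<lambda>\<omega>. g (Y \<omega>) * h (Y \<omega>))"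
      unfolding \<mu>_def by (simp add: integral_distr)
    finally show "expectation (\<lambda>\<omega>. indicator E \<omega> * h (Y \<omega>)) = expectation (\<lambda>\<omega>. g (Y \<omega>) * h (Y \<omega>))" .
  qed
qed

section \<open>Number of users close to user 1\<close>

text \<open>Let S be the count. If S \<ge> K, the first term suffices; otherwise 1 \<le> 2^K *
  2^(-S). The power 2^(-S) is a product of independent variables, each of mean at most 1 - \<rho> /
  2, which gives the exponential as in a Chernoff bound. The 1 under the root stands for user 1, who
  is always near.\<close>

lemma (in prob_space) expectation_inverse_sqrt_count_le:
  assumes indep: "indep_vars (\<lambda>_. N) V I" and I: "finite I" and A: "A \<in> sets N"
    and \<rho>: "\<And>i. i \<in> I \<Longrightarrow> \<rho> \<le> prob {\<omega> \<in> space M. V i \<omega> \<in> A}"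
  shows "expectation (\<lambda>\<omega>. 1 / sqrt (1 + real (card {i \<in> I. V i \<omega> \<in> A})))
           \<le> 1 / sqrt (1 + real K) + 2 ^ K * exp (- \<rho> * real (card I) / 2)"
proof -
  define Z where "Z v = (if v \<in> A then 1 / 2 else 1 :: real)" for v
  have V: "V i \<in> measurable M N" if "i \<in> I" for i
    using indep that by (auto simp: indep_vars_def)
  have ZN [measurable]: "Z \<in> borel_measurable N" unfolding Z_def using A by measurable
  have ZV [measurable]: "(\<lambda>\<omega>. Z (V i \<omega>)) \<in> borel_measurable M" if "i \<in> I" for i
    using measurable_compose[OF V[OF that] ZN] .
  have Z1: "\<bar>Z v\<bar> \<le> 1" for v by (simp add: Z_def)
  have int: "integrable M (\<lambda>\<omega>. Z (V i \<omega>))" if "i \<in> I" for i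
    using that by (intro integrable_const_bound[where B=1]) (simp_all add: ZV Z1)
  have EZ: "expectation (\<lambda>\<omega>. Z (V i \<omega>)) \<le> exp (- \<rho> / 2)" if i: "i \<in> I" for i
  proof -
    have [measurable]: "{\<omega> \<in> space M. V i \<omega> \<in> A} \<in> events"
      using measurable_sets[OF V[OF i] A] by (simp add: vimage_def Int_def conj_commute)
    have "expectation (\<lambda>\<omega>. Z (V i \<omega>)) = expectation (\<lambda>\<omega>. 1 - indicator {\<omega> \<in> space M. V i \<omega> \<in> A} \<omega> / 2)"
      by (intro Bochner_Integration.integral_cong) (auto simp: Z_def indicator_def)
    also have "\<dots> = 1 - prob {\<omega> \<in> space M. V i \<omega> \<in> A} / 2"
      by (subst Bochner_Integration.integral_diff) (auto simp: prob_space less_top[symmetric])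
    also have "\<dots> \<le> 1 + - \<rho> / 2" using \<rho>[OF i] by simp
    also have "\<dots> \<le> exp (- \<rho> / 2)" by (rule exp_ge_add_one_self)
    finally show ?thesis .
  qed
  have prodE: "expectation (\<lambda>\<omega>. \<Prod>i\<in>I. Z (V i \<omega>)) \<le> exp (- \<rho> * real (card I) / 2)"
  proof -
    have "expectation (\<lambda>\<omega>. \<Prod>i\<in>I. Z (V i \<omega>)) = (\<Prod>i\<in>I. expectation (\<lambda>\<omega>. Z (V i \<omega>)))"
      using I int by (intro indep_vars_lebesgue_integral indep_vars_compose2[OF indep]) auto
    also have "\<dots> \<le> (\<Prod>i\<in>I. exp (- \<rho> / 2))"
      using EZ by (intro prod_mono) (auto simp: Z_def intro!: Bochner_Integration.integral_nonneg)
    also have "\<dots> = exp (- \<rho> * real (card I) / 2)"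
      by (simp flip: exp_of_nat_mult)
    finally show ?thesis .
  qed
  have prod_card: "(\<Prod>i\<in>I. Z (V i \<omega>)) = (1 / 2) ^ card {i \<in> I. V i \<omega> \<in> A}" for \<omega>
    using I unfolding Z_def by (simp add: prod.If_cases Int_def)
  have card_meas: "(\<lambda>\<omega>. real (card {i \<in> I. V i \<omega> \<in> A})) \<in> borel_measurable M"
  proof -
    have "(\<lambda>\<omega>. \<Sum>i\<in>I. indicator A (V i \<omega>) :: real) \<in> borel_measurable M"
      using A V by (intro borel_measurable_sum measurable_compose[OF _ borel_measurable_indicator]) auto
    moreover have "(\<Sum>i\<in>I. indicator A (V i \<omega>) :: real) = real (card {i \<in> I. V i \<omega> \<in> A})" for \<omega>
      using I by (simp add: indicator_def sum.If_cases Int_def)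
    ultimately show ?thesis by simp
  qed
  have "expectation (\<lambda>\<omega>. 1 / sqrt (1 + real (card {i \<in> I. V i \<omega> \<in> A})))
      \<le> expectation (\<lambda>\<omega>. 1 / sqrt (1 + real K) + 2 ^ K * (\<Prod>i\<in>I. Z (V i \<omega>)))"
  proof (rule integral_mono)
    show "integrable M (\<lambda>\<omega>. 1 / sqrt (1 + real (card {i \<in> I. V i \<omega> \<in> A})))"
      using card_meas by (intro integrable_const_bound[where B=1]) auto
    show "integrable M (\<lambda>\<omega>. 1 / sqrt (1 + real K) + 2 ^ K * (\<Prod>i\<in>I. Z (V i \<omega>)))"
      using I int by (intro Bochner_Integration.integrable_add integrable_mult_right indep_vars_integrable
          indep_vars_compose2[OF indep]) auto
    fix \<omega> assume "\<omega> \<in> space M"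
    define S where "S = card {i \<in> I. V i \<omega> \<in> A}"
    have "1 / sqrt (1 + real S) \<le> 1 / sqrt (1 + real K) + 2 ^ K * (1 / 2) ^ S"
    proof (cases "K \<le> S")
      case True
      then have "1 / sqrt (1 + real S) \<le> 1 / sqrt (1 + real K)"
        by (intro divide_left_mono mult_pos_pos) auto
      then show ?thesis by (simp add: add_increasing2)
    next
      case False
      then have "(2::real) ^ S \<le> 2 ^ K" by (intro power_increasing) auto
      then have "1 \<le> 2 ^ K * (1 / 2 :: real) ^ S" by (simp add: power_divide)
      moreover have "1 / sqrt (1 + real S) \<le> 1" by simp
      ultimately have "1 / sqrt (1 + real S) \<le> 2 ^ K * (1 / 2) ^ S" by linarith
      then show ?thesis by (simp add: add_increasing)
    qed
    then show "1 / sqrt (1 + real (card {i \<in> I. V i \<omega> \<in> A})) \<le> 1 / sqrt (1 + real K) + 2 ^ K * (\<Prod>i\<in>I. Z (V i \<omega>))"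
      by (simp add: prod_card S_def)
  qed
  also have "\<dots> = 1 / sqrt (1 + real K) + 2 ^ K * expectation (\<lambda>\<omega>. \<Prod>i\<in>I. Z (V i \<omega>))"
    using I int by (subst Bochner_Integration.integral_add)
      (auto simp: prob_space intro!: integrable_mult_right indep_vars_integrable indep_vars_compose2[OF indep])
  also have "\<dots> \<le> 1 / sqrt (1 + real K) + 2 ^ K * exp (- \<rho> * real (card I) / 2)"
    using prodE by simp
  finally show ?thesis .
qed

section \<open>Observations\<close>

text \<open>The observations as a deterministic function of permutation and array, so that their
  invariance can be stated without probability. The array may contain times beyond
  \<open>m\<close>.\<close>

definition observation_of :: "nat \<Rightarrow> nat \<Rightarrow> (nat \<Rightarrow> nat) \<Rightarrow> (nat \<times> nat \<Rightarrow> nat) \<Rightarrow> nat \<times> nat \<Rightarrow> nat" where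
  "observation_of m n \<pi> x = (\<lambda>(t, v)\<in>{1..m} \<times> {1..n}. x (inv \<pi> v, t))"

lemma inv_permutation_upto_mem: "\<pi> \<in> permutations_upto n \<Longrightarrow> v \<in> {1..n} \<Longrightarrow> inv \<pi> v \<in> {1..n}"
  by (simp add: permutations_upto_def permutes_in_image[OF permutes_inv] del: atLeastAtMost_iff)

lemma observation_of_mem:
  assumes "\<pi> \<in> permutations_upto n" "x \<in> {1..n} \<times> T \<rightarrow>\<^sub>E {..<r}" "{1..m} \<subseteq> T"
  shows "observation_of m n \<pi> x \<in> space (matrix_space r m n)"
proof -
  have "x (inv \<pi> v, t) \<in> {..<r}" if "t \<in> {1..m}" "v \<in> {1..n}" for t v
    using PiE_mem[OF assms(2)] inv_permutation_upto_mem[OF assms(1) that(2)] that(1) assms(3) by blast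
  then show ?thesis
    unfolding observation_of_def matrix_space_def space_count_space by (intro restrict_PiE_iff[THEN iffD2]) auto
qed

text \<open>Column \<open>v\<close> shows user \<open>inv \<pi> v\<close>. Composing \<pi> with the
  transposition relabels this user, and exchanging the traces undoes the relabelling.\<close>

lemma observation_of_swap_users:
  assumes \<pi>: "\<pi> \<in> permutations_upto n" and u: "u \<in> {1..n}" and T: "{1..m} \<subseteq> T"
  shows "observation_of m n (\<pi> \<circ> Transposition.transpose 1 u) (swap_users u ({1..n} \<times> T) x) = observation_of m n \<pi> x"
proof -
  have "bij \<pi>" using \<pi> by (auto simp: permutations_upto_def permutes_bij)
  then have inv: "inv (\<pi> \<circ> Transposition.transpose 1 u) = Transposition.transpose 1 u \<circ> inv \<pi>"
    by (subst o_inv_distrib) auto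
  have "(Transposition.transpose 1 u (inv \<pi> v), t) \<in> {1..n} \<times> T" if "(t, v) \<in> {1..m} \<times> {1..n}" for t v
    using inv_permutation_upto_mem[OF \<pi>, of v] transpose_mem_users[OF u, of "inv \<pi> v"] that T by blast
  then show ?thesis
    unfolding observation_of_def inv swap_users_def by (intro restrict_ext) auto
qed

section \<open>The adversary's knowledge and its correlation with the centred indicator of user
  1\<close>

context anonymized_locations
begin

definition user_set :: "nat \<Rightarrow> (nat \<Rightarrow> real) \<Rightarrow> real \<Rightarrow> 'a \<Rightarrow> nat set" where
  "user_set n q \<epsilon> \<omega> = {u \<in> {1..n}. \<forall>j<r. \<bar>p u \<omega> j - q j\<bar> \<le> \<epsilon>}"

definition params_upto :: "nat \<Rightarrow> 'a \<Rightarrow> nat \<Rightarrow> nat \<Rightarrow> real" where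
  "params_upto n \<omega> = (\<lambda>u\<in>{1..n}. p u \<omega>)"

text \<open>Conditional mutual information is defined by the chain rule as I(X; (Y, P)) - I(X; P),
  so the pair is what the posterior depends on.\<close>

abbreviation "knowledge m n \<omega> \<equiv> (obs_matrix X (Perm n \<omega>) m n \<omega>, params_upto n \<omega>)"

abbreviation "knowledge_space m n \<equiv> matrix_space r m n \<Otimes>\<^sub>M PiM {1..n} (\<lambda>_. vec_space r)"

lemma params_upto_measurable_params: "params_upto n \<in> measurable params (PiM {1..n} (\<lambda>_. vec_space r))"
  unfolding params_upto_def using p_measurable_params by (intro measurable_restrict) auto

lemma obs_matrix_eq:
  assumes n: "n \<ge> 1" and \<omega>: "\<omega> \<in> space M" and T: "{1..m} \<subseteq> T"
  shows "obs_matrix X (Perm n \<omega>) m n \<omega> = observation_of m n (Perm n \<omega>) (\<lambda>c\<in>{1..n} \<times> T. X (fst c) (snd c) \<omega>)"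
proof -
  have "Perm n \<omega> \<in> permutations_upto n" using measurable_space[OF Perm_rv[OF n] \<omega>] by simp
  note inv_permutation_upto_mem[OF this]
  then show ?thesis
    unfolding obs_matrix_def observation_of_def using T
    by (intro restrict_ext) (auto simp: subset_iff simp del: atLeastAtMost_iff)
qed

lemma obs_matrix_measurable:
  assumes n: "n \<ge> 1"
  shows "(\<lambda>\<omega>. obs_matrix X (Perm n \<omega>) m n \<omega>) \<in> measurable M (matrix_space r m n)"
proof -
  define D where "D = {1..n} \<times> {1..m}"
  have X: "(\<lambda>\<omega>. \<lambda>c\<in>D. X (fst c) (snd c) \<omega>) \<in> measurable M (count_space (D \<rightarrow>\<^sub>E {..<r}))"
    using count_space_PiM_finite[of D "\<lambda>_. {..<r}"] X_rv
    by (auto simp: D_def simp flip: count_space_PiM_finite intro!: measurable_restrict)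
  have "(\<lambda>\<omega>. observation_of m n (Perm n \<omega>) (\<lambda>c\<in>D. X (fst c) (snd c) \<omega>)) \<in> measurable M (matrix_space r m n)"
  proof (rule measurable_compose_countable'[OF _ Perm_rv[OF n]])
    fix \<pi> assume "\<pi> \<in> permutations_upto n"
    then have "observation_of m n \<pi> \<in> measurable (count_space (D \<rightarrow>\<^sub>E {..<r})) (matrix_space r m n)"
      by (auto simp: D_def simp del: One_nat_def intro: observation_of_mem[OF _ _ order_refl])
    with X show "(\<lambda>\<omega>. observation_of m n \<pi> (\<lambda>c\<in>D. X (fst c) (snd c) \<omega>)) \<in> measurable M (matrix_space r m n)"
      by (rule measurable_compose)
  qed (simp add: countable_finite)
  then show ?thesis
    by (rule measurable_cong[THEN iffD1, rotated]) (simp add: obs_matrix_eq[OF n _ order_refl] D_def)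
qed

lemma knowledge_measurable: "n \<ge> 1 \<Longrightarrow> knowledge m n \<in> measurable M (knowledge_space m n)"
  by (intro measurable_Pair obs_matrix_measurable measurable_params_M[OF params_upto_measurable_params])

lemma card_user_set_measurable: "(\<lambda>\<omega>. real (card (user_set n q \<epsilon> \<omega>))) \<in> borel_measurable M"
proof -
  have [measurable]: "(\<lambda>\<omega>. p u \<omega> j) \<in> borel_measurable M" if "u \<in> {1..n}" "j \<in> {..<r}" for u j
    using that by (intro measurable_params_M p_component_measurable_params) auto
  have "(\<Sum>u\<in>{1..n}. if \<forall>j\<in>{..<r}. \<bar>p u \<omega> j - q j\<bar> \<le> \<epsilon> then 1 else 0) = real (card (user_set n q \<epsilon> \<omega>))" for \<omega>
    by (simp add: user_set_def sum.If_cases Int_def lessThan_def)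
  from this[symmetric] show ?thesis
    by (rule ssubst[OF ext]) measurable
qed

text \<open>For each outcome the swap inequality is applied with \<open>user_set\<close> as
  \<open>J\<close>. The parameters stay fixed when traces are swapped, so \<open>h\<close> may
  depend on them and is still invariant.\<close>

lemma centred_indicator_expectation_le:
  fixes h :: "(nat \<times> nat \<Rightarrow> nat) \<times> (nat \<Rightarrow> nat \<Rightarrow> real) \<Rightarrow> real"
  assumes n: "n \<ge> 1" and k: "k \<ge> 1" and i: "i < r"
    and p1: "\<And>\<omega> j. \<omega> \<in> space M \<Longrightarrow> j < r \<Longrightarrow> p 1 \<omega> j = q j"
    and \<kappa>: "0 < \<kappa>" "\<And>j. j < r \<Longrightarrow> \<kappa> \<le> q j" and \<epsilon>: "0 \<le> \<epsilon>"
    and h: "h \<in> borel_measurable (knowledge_space m n)" "\<And>y. \<bar>h y\<bar> \<le> 1"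
  shows "\<bar>expectation (\<lambda>\<omega>. (of_bool (X 1 k \<omega> = i) - q i) * h (knowledge m n \<omega>))\<bar>
     \<le> expectation (\<lambda>\<omega>. 1 / sqrt (real (card (user_set n q \<epsilon> \<omega>)))) + \<epsilon>
         + sqrt (8 * (real (m + 1) * real r * \<epsilon>\<^sup>2 / \<kappa>))"
proof -
  \<comment> \<open>The time \<open>k\<close> may exceed \<open>m\<close>; it is adjoined to the
    observed times, whence \<open>m + 1\<close> in the bound.\<close>
  define T where "T = insert k {1..m}"
  define D where "D = {1..n} \<times> T"
  define \<Phi> where "\<Phi> \<pi> x \<omega> = (of_bool (x (1, k) = i) - q i) * h (observation_of m n \<pi> x, params_upto n \<omega>)" for \<pi> x \<omega>
  define B where "B \<omega> = 1 / sqrt (real (card (user_set n q \<epsilon> \<omega>))) + \<epsilon> + sqrt (8 * (real (card T) * real r * \<epsilon>\<^sup>2 / \<kappa>))" for \<omega>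
  define R where "R \<omega> = (\<Sum>\<pi>\<in>permutations_upto n. \<Sum>x\<in>D \<rightarrow>\<^sub>E {..<r}. locations_pmf (\<lambda>u. p u \<omega>) D x * \<Phi> \<pi> x \<omega>) / fact n" for \<omega>
  have T: "finite T" "k \<in> T" "{1..m} \<subseteq> T" "T \<subseteq> {1..}" using k by (auto simp: T_def)
  have D: "finite D" "D \<subseteq> {1..} \<times> {1..}" using T by (auto simp: D_def)
  obtain \<omega>0 where \<omega>0: "\<omega>0 \<in> space M" using not_empty by blast
  have qi: "0 \<le> q i" "q i \<le> 1"
    using p_prob[of 1 \<omega>0] p1[OF \<omega>0] \<omega>0 i member_le_sum[of i "{..<r}" "p 1 \<omega>0"] by (auto simp: prob_vector_def)
  have "\<bar>of_bool b - q i\<bar> \<le> 1" for b :: bool using qi by (cases b) auto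
  then have \<Phi>1: "\<bar>\<Phi> \<pi> x \<omega>\<bar> \<le> 1" for \<pi> x \<omega>
    unfolding \<Phi>_def abs_mult using h(2) by (intro mult_le_one) auto
  have \<Phi>_meas: "\<Phi> \<pi> x \<in> borel_measurable params" if "\<pi> \<in> permutations_upto n" "x \<in> D \<rightarrow>\<^sub>E {..<r}" for \<pi> x
  proof -
    have "observation_of m n \<pi> x \<in> space (matrix_space r m n)"
      using that T by (intro observation_of_mem) (auto simp: D_def)
    then have "(\<lambda>\<omega>. (observation_of m n \<pi> x, params_upto n \<omega>)) \<in> measurable params (knowledge_space m n)"
      using params_upto_measurable_params by (intro measurable_Pair measurable_const) auto
    from measurable_compose[OF this h(1)] show ?thesis
      unfolding \<Phi>_def by (intro borel_measurable_times) auto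
  qed
  have "expectation (\<lambda>\<omega>. (of_bool (X 1 k \<omega> = i) - q i) * h (knowledge m n \<omega>))
      = expectation (\<lambda>\<omega>. \<Phi> (Perm n \<omega>) (\<lambda>c\<in>D. X (fst c) (snd c) \<omega>) \<omega>)"
    using n T by (intro Bochner_Integration.integral_cong) (auto simp: \<Phi>_def obs_matrix_eq[OF n _ T(3)] D_def)
  also have "\<dots> = expectation R"
    unfolding R_def using n D \<Phi>_meas \<Phi>1 by (intro expectation_Perm_locations) auto
  finally have eq: "expectation (\<lambda>\<omega>. (of_bool (X 1 k \<omega> = i) - q i) * h (knowledge m n \<omega>)) = expectation R" .
  have R_le: "\<bar>R \<omega>\<bar> \<le> B \<omega>" if \<omega>: "\<omega> \<in> space M" for \<omega>
  proof -
    have "\<bar>\<Sum>\<pi>\<in>permutations_upto n. \<Sum>x\<in>{1..n} \<times> T \<rightarrow>\<^sub>E {..<r}.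
            locations_pmf (\<lambda>u. p u \<omega>) ({1..n} \<times> T) x * ((of_bool (x (1, k) = i) - p 1 \<omega> i) * h (observation_of m n \<pi> x, params_upto n \<omega>))\<bar>
         \<le> fact n * (1 / sqrt (real (card (user_set n q \<epsilon> \<omega>))) + \<epsilon> + sqrt (8 * (real (card T) * real r * \<epsilon>\<^sup>2 / \<kappa>)))"
    proof (rule abs_sum_centred_indicator_le)
      show "1 \<in> user_set n q \<epsilon> \<omega>" using n p1[OF \<omega>] \<epsilon> by (simp add: user_set_def)
      show "finite T" "k \<in> T" "0 < \<kappa>" "i < r" using T \<kappa> i by auto
      show "user_set n q \<epsilon> \<omega> \<subseteq> {1..n}" by (auto simp: user_set_def)
      show "prob_vector r (p w \<omega>)" if "w \<in> {1..n}" for w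
        using p_prob[of w \<omega>] that \<omega> by simp
      show "\<kappa> \<le> p 1 \<omega> j" if "j < r" for j
        unfolding p1[OF \<omega> that] by (rule \<kappa>(2)[OF that])
      show "\<bar>p u \<omega> j - p 1 \<omega> j\<bar> \<le> \<epsilon>" if "u \<in> user_set n q \<epsilon> \<omega>" "j < r" for u j
        unfolding p1[OF \<omega> that(2)] using that by (simp add: user_set_def)
      show "\<bar>h (observation_of m n \<pi> x, params_upto n \<omega>)\<bar> \<le> 1" for \<pi> x
        by (rule h(2))
      show "h (observation_of m n (\<pi> \<circ> Transposition.transpose 1 u) (swap_users u ({1..n} \<times> T) x), params_upto n \<omega>)
          = h (observation_of m n \<pi> x, params_upto n \<omega>)"
        if "\<pi> \<in> permutations_upto n" "u \<in> {1..n}" for \<pi> x u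
        using observation_of_swap_users[OF that T(3)] by simp
    qed
    moreover have "R \<omega> = (\<Sum>\<pi>\<in>permutations_upto n. \<Sum>x\<in>{1..n} \<times> T \<rightarrow>\<^sub>E {..<r}.
            locations_pmf (\<lambda>u. p u \<omega>) ({1..n} \<times> T) x * ((of_bool (x (1, k) = i) - p 1 \<omega> i) * h (observation_of m n \<pi> x, params_upto n \<omega>))) / fact n"
      by (simp only: R_def \<Phi>_def D_def p1[OF \<omega> i])
    ultimately show ?thesis
      unfolding B_def by (simp add: abs_divide divide_le_eq mult.commute)
  qed
  have B_int: "integrable M (\<lambda>\<omega>. 1 / sqrt (real (card (user_set n q \<epsilon> \<omega>))))"
  proof (rule integrable_const_bound[where B=1])
    have "1 / sqrt (real c) \<le> 1" for c :: nat
      by (cases "c = 0") auto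
    then show "AE \<omega> in M. norm (1 / sqrt (real (card (user_set n q \<epsilon> \<omega>)))) \<le> 1" by simp
    show "(\<lambda>\<omega>. 1 / sqrt (real (card (user_set n q \<epsilon> \<omega>)))) \<in> borel_measurable M"
      using card_user_set_measurable by measurable
  qed
  \<comment> \<open>If \<open>R\<close> were not integrable, its integral would be 0 by convention,
    and \<open>B\<close> is nonnegative.\<close>
  have "\<bar>expectation R\<bar> \<le> expectation B"
  proof (cases "integrable M R")
    case True
    then have "\<bar>expectation R\<bar> \<le> expectation (\<lambda>\<omega>. \<bar>R \<omega>\<bar>)"
      by (intro integral_abs_bound)
    also have "\<dots> \<le> expectation B"
      using True R_le B_int unfolding B_def by (intro integral_mono) auto
    finally show ?thesis .
  next
    case False
    have "0 \<le> expectation B"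
      using \<epsilon> \<kappa> by (intro Bochner_Integration.integral_nonneg) (auto simp: B_def)
    then show ?thesis using False by (simp add: not_integrable_integral_eq)
  qed
  also have "expectation B = expectation (\<lambda>\<omega>. 1 / sqrt (real (card (user_set n q \<epsilon> \<omega>)))) + \<epsilon> + sqrt (8 * (real (card T) * real r * \<epsilon>\<^sup>2 / \<kappa>))"
    unfolding B_def using B_int by (simp add: prob_space)
  also have "sqrt (8 * (real (card T) * real r * \<epsilon>\<^sup>2 / \<kappa>)) \<le> sqrt (8 * (real (m + 1) * real r * \<epsilon>\<^sup>2 / \<kappa>))"
  proof -
    have "card T \<le> m + 1" unfolding T_def by (rule order_trans[OF card_insert_le_m1]) auto
    then show ?thesis
      using \<kappa>(1) by (intro real_sqrt_le_mono mult_left_mono divide_right_mono mult_right_mono) auto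
  qed
  finally show ?thesis unfolding eq by simp
qed

end

text \<open>The first r - 1 coordinates are confined to a cube of half-side \<epsilon> / r about
  those of \<open>q\<close>. The last coordinate is then off by at most (r - 1) * \<epsilon> / r,
  which stays below \<epsilon>. Since every coordinate of \<open>q\<close> is at least \<epsilon>,
  the cube lies inside the region where the density exceeds \<delta>.\<close>

lemma (in prob_space) prob_near_ge_of_density:
  assumes r: "r \<ge> 2" and q: "prob_vector r q" and \<epsilon>: "0 < \<epsilon>" "\<And>j. j < r \<Longrightarrow> \<epsilon> \<le> q j"
    and P: "P \<in> measurable M (vec_space r)" "\<And>\<omega>. \<omega> \<in> space M \<Longrightarrow> prob_vector r (P \<omega>)"
    and dens: "distributed M (PiM {..<r - 1} (\<lambda>_. lborel)) (\<lambda>\<omega>. restrict (P \<omega>) {..<r - 1}) (\<lambda>x. ennreal (f x))"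
    and \<delta>: "\<And>x. x \<in> param_region r \<Longrightarrow> \<delta> < f x" "0 < \<delta>"
  shows "\<delta> * (2 * \<epsilon> / real r) ^ (r - 1) \<le> prob {\<omega> \<in> space M. \<forall>j<r. \<bar>P \<omega> j - q j\<bar> \<le> \<epsilon>}"
proof -
  define d where "d = r - 1"
  have d: "r = Suc d" "d \<ge> 1" using r by (auto simp: d_def)
  define e where "e = \<epsilon> / real r"
  have e0: "0 < e" using \<epsilon> r by (simp add: e_def)
  have de: "real d * e < \<epsilon>" "e \<le> \<epsilon>" using \<epsilon> d by (auto simp: e_def field_simps)
  have qsum: "(\<Sum>j<d. q j) + q d = 1" using q by (simp add: prob_vector_def d(1))
  define C where "C = (\<Pi>\<^sub>E j\<in>{..<d}. {q j - e<..<q j + e})"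
  interpret L: product_sigma_finite "\<lambda>_::nat. lborel :: real measure" ..
  have C_sets: "C \<in> sets (PiM {..<d} (\<lambda>_. lborel))"
    unfolding C_def by (intro sets_PiM_I_finite) auto
  have C_vol: "emeasure (PiM {..<d} (\<lambda>_. lborel)) C = ennreal ((2 * e) ^ d)"
    unfolding C_def using e0 by (subst L.emeasure_PiM) (auto simp: ennreal_power)
  have C_region: "C \<subseteq> param_region r"
  proof
    fix x assume x: "x \<in> C"
    have xj: "q j - e < x j" "x j < q j + e" if "j < d" for j
      using x that by (auto simp: C_def PiE_iff)
    have pos: "0 < x j" if "j < d" for j
      using xj[OF that] \<epsilon>(2)[of j] de that d by auto
    have "(\<Sum>j<d. x j) \<le> (\<Sum>j<d. q j + e)"
      using xj by (intro sum_mono less_imp_le) auto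
    \<comment> \<open>The slack is the last coordinate \<open>q d\<close>, which is at least
      \<epsilon> and so exceeds d * e.\<close>
    also have "\<dots> < 1"
      using qsum de \<epsilon>(2)[of d] by (simp add: sum.distrib d(1))
    finally have sum: "(\<Sum>j<d. x j) < 1" .
    have "x j < 1" if "j < d" for j
      using member_le_sum[of j "{..<d}" x] sum pos that by (auto simp: less_imp_le)
    then show "x \<in> param_region r"
      using x pos sum by (auto simp: param_region_def C_def d(1) PiE_iff)
  qed
  have meas: "(\<lambda>\<omega>. restrict (P \<omega>) {..<d}) \<in> measurable M (PiM {..<d} (\<lambda>_. lborel))"
    using distributed_measurable[OF dens] by (simp add: d_def)
  have [measurable]: "(\<lambda>\<omega>. P \<omega> j) \<in> borel_measurable M" if "j \<in> {..<r}" for j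
    using measurable_compose[OF P(1)[unfolded vec_space_def] measurable_component_singleton[OF that]] .
  have "ennreal (\<delta> * (2 * e) ^ d) = (\<integral>\<^sup>+x. ennreal \<delta> * indicator C x \<partial>PiM {..<d} (\<lambda>_. lborel))"
    using C_sets C_vol \<delta>(2) e0 by (simp add: nn_integral_cmult ennreal_mult)
  also have "\<dots> \<le> (\<integral>\<^sup>+x. ennreal (f x) * indicator C x \<partial>PiM {..<d} (\<lambda>_. lborel))"
  proof (rule nn_integral_mono)
    fix x
    have "ennreal \<delta> \<le> ennreal (f x)" if "x \<in> C"
      using \<delta>(1)[of x] C_region that by (intro ennreal_leI) auto
    then show "ennreal \<delta> * indicator C x \<le> ennreal (f x) * indicator C x"
      by (simp add: indicator_def)
  qed
  also have "\<dots> = emeasure M ((\<lambda>\<omega>. restrict (P \<omega>) {..<d}) -` C \<inter> space M)"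
    using distributed_emeasure[OF dens] C_sets by (simp add: d_def)
  also have "\<dots> \<le> emeasure M {\<omega> \<in> space M. \<forall>j\<in>{..<r}. \<bar>P \<omega> j - q j\<bar> \<le> \<epsilon>}"
  proof (rule emeasure_mono)
    show "(\<lambda>\<omega>. restrict (P \<omega>) {..<d}) -` C \<inter> space M \<subseteq> {\<omega> \<in> space M. \<forall>j\<in>{..<r}. \<bar>P \<omega> j - q j\<bar> \<le> \<epsilon>}"
    proof (intro subsetI CollectI conjI ballI)
      fix \<omega> j assume "\<omega> \<in> (\<lambda>\<omega>. restrict (P \<omega>) {..<d}) -` C \<inter> space M" and j: "j \<in> {..<r}"
      then have \<omega>: "\<omega> \<in> space M" "restrict (P \<omega>) {..<d} \<in> C" by auto
      have close: "\<bar>P \<omega> j - q j\<bar> \<le> e" if "j < d" for j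
      proof -
        have "q j - e < P \<omega> j \<and> P \<omega> j < q j + e"
          using PiE_mem[OF \<omega>(2)[unfolded C_def], of j] that by simp
        then show ?thesis by linarith
      qed
      have "(\<Sum>j<d. P \<omega> j) + P \<omega> d = 1" using P(2)[OF \<omega>(1)] by (simp add: prob_vector_def d(1))
      then have "P \<omega> d - q d = (\<Sum>j<d. q j - P \<omega> j)"
        using qsum by (simp add: sum_subtractf)
      also have "\<bar>\<dots>\<bar> \<le> (\<Sum>j<d. e)"
        using close by (intro order_trans[OF sum_abs] sum_mono) (simp add: abs_minus_commute)
      finally have "\<bar>P \<omega> d - q d\<bar> \<le> \<epsilon>" using de by simp
      moreover have "\<bar>P \<omega> j - q j\<bar> \<le> \<epsilon>" if "j < d" using close[OF that] de by simp
      ultimately show "\<bar>P \<omega> j - q j\<bar> \<le> \<epsilon>"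
        using j d by (cases "j = d") auto
    qed auto
    show "{\<omega> \<in> space M. \<forall>j\<in>{..<r}. \<bar>P \<omega> j - q j\<bar> \<le> \<epsilon>} \<in> events" by measurable
  qed
  also have "\<dots> = ennreal (prob {\<omega> \<in> space M. \<forall>j<r. \<bar>P \<omega> j - q j\<bar> \<le> \<epsilon>})"
    by (simp add: emeasure_eq_measure Ball_def lessThan_def)
  finally show ?thesis
    by (simp add: d_def e_def)
qed

section \<open>Conditional mutual information for a fixed number of users\<close>

context anonymized_locations
begin

text \<open>The conditional probability of the location of user 1 is the constant
  \<open>q i\<close>, so this location is independent of all parameters.\<close>

lemma measure_location_params:
  assumes k: "k \<ge> 1" and i: "i < r"
    and p1: "\<And>\<omega> j. \<omega> \<in> space M \<Longrightarrow> j < r \<Longrightarrow> p 1 \<omega> j = q j" and qi: "0 \<le> q i"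
    and A: "A \<in> sets params"
  shows "measure M {\<omega> \<in> space M. X 1 k \<omega> = i \<and> \<omega> \<in> A} = q i * measure M A"
proof -
  have AM: "A \<in> events" using A subalgebra_params by (auto simp: subalgebra_def)
  define x where "x = (\<lambda>c\<in>{(1::nat, k)}. i)"
  have D: "finite {(1::nat, k)}" "{(1::nat, k)} \<subseteq> {1..} \<times> {1..}" "x \<in> {(1, k)} \<rightarrow>\<^sub>E {..<r}"
    using k i by (auto simp: x_def)
  have "expectation (\<lambda>\<omega>. indicator A \<omega> * indicator (locations_event {(1, k)} x) \<omega>)
      = expectation (\<lambda>\<omega>. indicator A \<omega> * locations_pmf (\<lambda>u. p u \<omega>) {(1, k)} x)"
    using A by (intro expectation_locations_event(2)[OF D, where C=1]) (auto simp: indicator_def)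
  also have "\<dots> = expectation (\<lambda>\<omega>. q i * indicator A \<omega>)"
    using p1 i by (intro Bochner_Integration.integral_cong) (auto simp: locations_pmf_def x_def)
  also have "\<dots> = q i * measure M A"
    using AM by simp
  also have "expectation (\<lambda>\<omega>. indicator A \<omega> * indicator (locations_event {(1, k)} x) \<omega> :: real)
      = expectation (indicator (A \<inter> locations_event {(1, k)} x))"
    by (intro Bochner_Integration.integral_cong) (auto simp: indicator_def)
  also have "\<dots> = measure M (A \<inter> locations_event {(1, k)} x)"
    using AM locations_event_M[OF D] by simp
  also have "A \<inter> locations_event {(1, k)} x = {\<omega> \<in> space M. X 1 k \<omega> = i \<and> \<omega> \<in> A}"
    by (auto simp: locations_event_def x_def)
  finally show ?thesis .
qed

lemma conditional_mutual_information_bounds: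
  fixes b \<kappa> \<epsilon> :: real and m n k :: nat and q :: "nat \<Rightarrow> real"
  assumes b: "b > 1" and n: "n \<ge> 1" and k: "k \<ge> 1"
    and p1: "\<And>\<omega> j. \<omega> \<in> space M \<Longrightarrow> j < r \<Longrightarrow> p 1 \<omega> j = q j"
    and \<kappa>: "0 < \<kappa>" "\<And>j. j < r \<Longrightarrow> \<kappa> \<le> q j" and \<epsilon>: "0 \<le> \<epsilon>"
  defines "I \<equiv> conditional_mutual_information b (count_space {..<r}) (matrix_space r m n) (PiM {1..n} (\<lambda>_. vec_space r))
           (X 1 k) (\<lambda>\<omega>. obs_matrix X (Perm n \<omega>) m n \<omega>) (params_upto n)"
  shows "0 \<le> I"
    and "I \<le> real r / (\<kappa> * ln b) * (expectation (\<lambda>\<omega>. 1 / sqrt (real (card (user_set n q \<epsilon> \<omega>)))) + \<epsilon>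
         + sqrt (8 * (real (m + 1) * real r * \<epsilon>\<^sup>2 / \<kappa>)))" (is "_ \<le> _ * ?B")
proof -
  interpret information_space M b by standard (rule b)
  have q0: "0 < q i" if "i < r" for i using \<kappa>(1) \<kappa>(2)[OF that] by simp
  have Xk: "X 1 k \<in> measurable M (count_space {..<r})" using X_rv k by simp
  have prob_X: "prob {\<omega> \<in> space M. X 1 k \<omega> = i} = q i" if i: "i < r" for i
  proof -
    have "{\<omega> \<in> space M. X 1 k \<omega> = i} = {\<omega> \<in> space M. X 1 k \<omega> = i \<and> \<omega> \<in> space M}" by auto
    then show ?thesis
      using measure_location_params[OF k i p1, of "space M"] q0[OF i] sets.top[of params] by (simp add: prob_space)
  qed
  have q1: "q i \<le> 1" if "i < r" for i
    using prob_X[OF that] by (metis prob_le_1)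
  have Z: "params_upto n \<in> measurable M (PiM {1..n} (\<lambda>_. vec_space r))"
    using measurable_params_M[OF params_upto_measurable_params] .
  have joint_Z: "emeasure M {\<omega> \<in> space M. X 1 k \<omega> = i \<and> params_upto n \<omega> \<in> A} = (\<integral>\<^sup>+\<omega>. ennreal (q i) * indicator A (params_upto n \<omega>) \<partial>M)"
    if i: "i < r" and A: "A \<in> sets (PiM {1..n} (\<lambda>_. vec_space r))" for i A
  proof -
    have Ap: "params_upto n -` A \<inter> space M \<in> sets params"
      using measurable_sets[OF params_upto_measurable_params A] by simp
    then have [measurable]: "params_upto n -` A \<inter> space M \<in> events"
      using subalgebra_params by (auto simp: subalgebra_def)
    have "{\<omega> \<in> space M. X 1 k \<omega> = i \<and> params_upto n \<omega> \<in> A} = {\<omega> \<in> space M. X 1 k \<omega> = i \<and> \<omega> \<in> params_upto n -` A \<inter> space M}"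
      by auto
    then have "emeasure M {\<omega> \<in> space M. X 1 k \<omega> = i \<and> params_upto n \<omega> \<in> A} = ennreal (q i * measure M (params_upto n -` A \<inter> space M))"
      using measure_location_params[OF k i p1 _ Ap] q0[OF i] by (simp add: emeasure_eq_measure less_imp_le)
    also have "\<dots> = (\<integral>\<^sup>+\<omega>. ennreal (q i) * indicator (params_upto n -` A \<inter> space M) \<omega> \<partial>M)"
      using q0[OF i] by (simp add: nn_integral_cmult emeasure_eq_measure ennreal_mult less_imp_le)
    also have "\<dots> = (\<integral>\<^sup>+\<omega>. ennreal (q i) * indicator A (params_upto n \<omega>) \<partial>M)"
      by (intro nn_integral_cong) (auto simp: indicator_def)
    finally show ?thesis .
  qed
  \<comment> \<open>Independence makes the constant \<open>q i\<close> a valid posterior, and its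
    chi-square divergence is 0.\<close>
  have MI_Z0: "mutual_information b (count_space {..<r}) (PiM {1..n} (\<lambda>_. vec_space r)) (X 1 k) (params_upto n) = 0"
  proof (rule antisym)
    have "mutual_information b (count_space {..<r}) (PiM {1..n} (\<lambda>_. vec_space r)) (X 1 k) (params_upto n)
       \<le> (\<Sum>i\<in>{..<r}. expectation (\<lambda>\<omega>. (q i - q i)\<^sup>2) / q i) / ln b"
      by (rule mutual_information_le_chi_square(2)[where g="\<lambda>i _. q i", OF _ Xk Z])
         (use q0 q1 prob_X joint_Z in \<open>auto simp: less_imp_le\<close>)
    then show "mutual_information b (count_space {..<r}) (PiM {1..n} (\<lambda>_. vec_space r)) (X 1 k) (params_upto n) \<le> 0"
      by simp
    show "0 \<le> mutual_information b (count_space {..<r}) (PiM {1..n} (\<lambda>_. vec_space r)) (X 1 k) (params_upto n)"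
      by (rule mutual_information_le_chi_square(1)[where g="\<lambda>i _. q i" and q=q, OF _ Xk Z])
         (use q0 q1 prob_X joint_Z in \<open>auto simp: less_imp_le\<close>)
  qed
  have W: "knowledge m n \<in> measurable M (knowledge_space m n)" by (rule knowledge_measurable[OF n])
  have ev: "{\<omega> \<in> space M. X 1 k \<omega> = i} \<in> events" for i
  proof (cases "i < r")
    case True
    then show ?thesis
      using measurable_sets[OF Xk, of "{i}"] by (simp add: vimage_def Int_def conj_commute)
  next
    case False
    then have "{\<omega> \<in> space M. X 1 k \<omega> = i} = {}" using measurable_space[OF Xk] by auto
    then show ?thesis by (metis sets.empty_sets)
  qed
  \<comment> \<open>One predicate collects all properties, so that a posterior can be chosen
    simultaneously for every location.\<close>
  define posterior where "posterior i g \<longleftrightarrow> g \<in> borel_measurable (knowledge_space m n) \<and> (\<forall>y. 0 \<le> g y \<and> g y \<le> 1) \<and>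
      (\<forall>A\<in>sets (knowledge_space m n). emeasure M {\<omega> \<in> space M. \<omega> \<in> {\<omega> \<in> space M. X 1 k \<omega> = i} \<and> knowledge m n \<omega> \<in> A}
          = (\<integral>\<^sup>+\<omega>. ennreal (g (knowledge m n \<omega>)) * indicator A (knowledge m n \<omega>) \<partial>M)) \<and>
      (\<forall>h\<in>borel_measurable (knowledge_space m n). expectation (\<lambda>\<omega>. indicator {\<omega> \<in> space M. X 1 k \<omega> = i} \<omega> * h (knowledge m n \<omega>))
          = expectation (\<lambda>\<omega>. g (knowledge m n \<omega>) * (h (knowledge m n \<omega>) :: real)))" for i g
  have "\<exists>g. posterior i g" for i
    by (rule posterior_exists[OF W ev[of i]]) (unfold posterior_def, blast)
  then obtain g where "\<And>i. posterior i (g i)"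
    using choice[of posterior] by blast
  note g_all = this[unfolded posterior_def]
  have g: "g i \<in> borel_measurable (knowledge_space m n)" "0 \<le> g i y" "g i y \<le> 1" for i y
    using g_all[of i] by blast+
  have g_exp: "expectation (\<lambda>\<omega>. indicator {\<omega> \<in> space M. X 1 k \<omega> = i} \<omega> * h (knowledge m n \<omega>))
          = expectation (\<lambda>\<omega>. g i (knowledge m n \<omega>) * (h (knowledge m n \<omega>) :: real))"
    if "h \<in> borel_measurable (knowledge_space m n)" for i h
    using g_all[of i] that by blast
  have joint: "emeasure M {\<omega> \<in> space M. X 1 k \<omega> = i \<and> knowledge m n \<omega> \<in> A}
          = (\<integral>\<^sup>+\<omega>. ennreal (g i (knowledge m n \<omega>)) * indicator A (knowledge m n \<omega>) \<partial>M)"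
    if "A \<in> sets (knowledge_space m n)" for i A
  proof -
    have "{\<omega> \<in> space M. X 1 k \<omega> = i \<and> knowledge m n \<omega> \<in> A} = {\<omega> \<in> space M. \<omega> \<in> {\<omega> \<in> space M. X 1 k \<omega> = i} \<and> knowledge m n \<omega> \<in> A}"
      by auto
    then show ?thesis using g_all[of i] that by simp
  qed
  have MI_W: "0 \<le> mutual_information b (count_space {..<r}) (knowledge_space m n) (X 1 k) (knowledge m n)"
    "mutual_information b (count_space {..<r}) (knowledge_space m n) (X 1 k) (knowledge m n)
       \<le> (\<Sum>i\<in>{..<r}. expectation (\<lambda>\<omega>. (g i (knowledge m n \<omega>) - q i)\<^sup>2) / q i) / ln b"
    by (rule mutual_information_le_chi_square[where g=g and q=q, OF finite_lessThan Xk W g(1) g(2) g(3) _ _ joint];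
        use q0 prob_X in simp)+
  have I: "I = mutual_information b (count_space {..<r}) (knowledge_space m n) (X 1 k) (knowledge m n)"
    unfolding I_def conditional_mutual_information_def MI_Z0 by simp
  show "0 \<le> I" using MI_W(1) by (simp add: I)
  have square: "expectation (\<lambda>\<omega>. (g i (knowledge m n \<omega>) - q i)\<^sup>2) \<le> ?B" if i: "i < r" for i
  proof -
    define h where "h y = g i y - q i" for y
    have h_meas [measurable]: "h \<in> borel_measurable (knowledge_space m n)"
      unfolding h_def[abs_def] using g(1)[of i] by (intro borel_measurable_diff) auto
    have h1: "\<bar>h y\<bar> \<le> 1" for y
      using g(2)[of i y] g(3)[of i y] q0[OF i] q1[OF i] by (auto simp: h_def abs_le_iff)
    have hW: "(\<lambda>\<omega>. h (knowledge m n \<omega>)) \<in> borel_measurable M" and gW: "(\<lambda>\<omega>. g i (knowledge m n \<omega>)) \<in> borel_measurable M"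
      using measurable_compose[OF W h_meas] measurable_compose[OF W g(1)[of i]] by auto
    have i1: "integrable M (\<lambda>\<omega>. h (knowledge m n \<omega>))"
      using hW h1 by (intro integrable_const_bound[where B=1]) auto
    have i2: "integrable M (\<lambda>\<omega>. g i (knowledge m n \<omega>) * h (knowledge m n \<omega>))"
      using hW gW h1 g by (intro integrable_const_bound[where B=1]) (auto simp: abs_mult intro!: mult_le_one)
    have i3: "integrable M (\<lambda>\<omega>. indicator {\<omega> \<in> space M. X 1 k \<omega> = i} \<omega> * h (knowledge m n \<omega>))"
      using integrable_mult_indicator[OF ev[of i] i1] by simp
    have "expectation (\<lambda>\<omega>. (g i (knowledge m n \<omega>) - q i)\<^sup>2)
        = expectation (\<lambda>\<omega>. g i (knowledge m n \<omega>) * h (knowledge m n \<omega>) - q i * h (knowledge m n \<omega>))"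
      by (simp add: h_def power2_eq_square algebra_simps)
    also have "\<dots> = expectation (\<lambda>\<omega>. g i (knowledge m n \<omega>) * h (knowledge m n \<omega>)) - expectation (\<lambda>\<omega>. q i * h (knowledge m n \<omega>))"
      using i1 i2 by (intro Bochner_Integration.integral_diff) auto
    \<comment> \<open>The projection step: against \<open>h\<close>, which depends on the knowledge
      only, the posterior may be replaced by the indicator.\<close>
    also have "\<dots> = expectation (\<lambda>\<omega>. indicator {\<omega> \<in> space M. X 1 k \<omega> = i} \<omega> * h (knowledge m n \<omega>)) - expectation (\<lambda>\<omega>. q i * h (knowledge m n \<omega>))"
      by (simp only: g_exp[OF h_meas, of i])
    also have "\<dots> = expectation (\<lambda>\<omega>. indicator {\<omega> \<in> space M. X 1 k \<omega> = i} \<omega> * h (knowledge m n \<omega>) - q i * h (knowledge m n \<omega>))"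
      using i1 i3 by (intro Bochner_Integration.integral_diff[symmetric]) auto
    also have "\<dots> = expectation (\<lambda>\<omega>. (of_bool (X 1 k \<omega> = i) - q i) * h (knowledge m n \<omega>))"
      by (intro Bochner_Integration.integral_cong) (auto simp: algebra_simps indicator_def)
    also have "\<dots> \<le> ?B"
      using centred_indicator_expectation_le[OF n k i p1 \<kappa> \<epsilon> h_meas h1] by linarith
    finally show ?thesis .
  qed
  have B0: "0 \<le> ?B"
    using \<epsilon> \<kappa>(1) by (intro add_nonneg_nonneg Bochner_Integration.integral_nonneg) auto
  \<comment> \<open>Each of the \<open>r\<close> locations contributes a mean square at most
    \<open>?B\<close> with weight 1 / q i \<le> 1 / \<kappa>.\<close>
  have "I \<le> (\<Sum>i\<in>{..<r}. ?B / \<kappa>) / ln b"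
    unfolding I using MI_W(2)
  proof (rule order_trans)
    show "(\<Sum>i\<in>{..<r}. expectation (\<lambda>\<omega>. (g i (knowledge m n \<omega>) - q i)\<^sup>2) / q i) / ln b \<le> (\<Sum>i\<in>{..<r}. ?B / \<kappa>) / ln b"
      using b square \<kappa> B0 by (intro divide_right_mono sum_mono frac_le) auto
  qed
  also have "\<dots> = real r / (\<kappa> * ln b) * ?B"
    by simp
  finally show "I \<le> real r / (\<kappa> * ln b) * ?B" .
qed

end

lemma (in anonymized_locations) card_user_set_eq:
  assumes n: "n \<ge> 1" and \<epsilon>: "0 \<le> \<epsilon>" and \<omega>: "\<omega> \<in> space M"
    and p1: "\<And>j. j < r \<Longrightarrow> p 1 \<omega> j = q j"
  shows "card (user_set n q \<epsilon> \<omega>) = Suc (card {u \<in> {2..n}. p u \<omega> \<in> {v \<in> space (vec_space r). \<forall>j\<in>{..<r}. \<bar>v j - q j\<bar> \<le> \<epsilon>}})"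
proof -
  have "user_set n q \<epsilon> \<omega> = insert 1 {u \<in> {2..n}. p u \<omega> \<in> {v \<in> space (vec_space r). \<forall>j\<in>{..<r}. \<bar>v j - q j\<bar> \<le> \<epsilon>}}"
  proof (rule set_eqI)
    fix u
    show "u \<in> user_set n q \<epsilon> \<omega> \<longleftrightarrow> u \<in> insert 1 {u \<in> {2..n}. p u \<omega> \<in> {v \<in> space (vec_space r). \<forall>j\<in>{..<r}. \<bar>v j - q j\<bar> \<le> \<epsilon>}}"
      using n p1 \<epsilon> measurable_space[OF p_rv \<omega>, of u] by (cases "u = 1") (auto simp: user_set_def)
  qed
  then show ?thesis by simp
qed

section \<open>Asymptotics\<close>

lemma powr_tendsto_0:
  fixes s :: real
  assumes "s < 0"
  shows "(\<lambda>n. real n powr s) \<longlonglongrightarrow> 0"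
  using assms by (intro tendsto_neg_powr filterlim_real_sequentially)

text \<open>An iterated limit: the majorant for a fixed cut-off \<open>K\<close> need not vanish as
  n grows, only its limit does as \<open>K\<close> grows. This avoids choosing \<open>K\<close> as a
  function of n.\<close>

lemma tendsto_0_if_eventually_le:
  fixes a :: "nat \<Rightarrow> real" and g :: "nat \<Rightarrow> nat \<Rightarrow> real"
  assumes a0: "eventually (\<lambda>n. 0 \<le> a n) sequentially"
    and le: "\<And>K. eventually (\<lambda>n. a n \<le> g K n) sequentially"
    and lim: "\<And>K. g K \<longlonglongrightarrow> l K" and l: "l \<longlonglongrightarrow> 0"
  shows "a \<longlonglongrightarrow> 0"
proof (rule order_tendstoI)
  fix e :: real assume "e < 0"
  then show "eventually (\<lambda>n. e < a n) sequentially"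
    using a0 by (auto elim!: eventually_mono)
next
  fix e :: real assume "0 < e"
  then have "eventually (\<lambda>K. l K < e) sequentially" by (rule order_tendstoD(2)[OF l])
  then obtain K where "l K < e" by (auto simp: eventually_sequentially)
  then have "eventually (\<lambda>n. g K n < e) sequentially" by (rule order_tendstoD(2)[OF lim])
  with le[of K] show "eventually (\<lambda>n. a n < e) sequentially"
    by eventually_elim simp
qed

text \<open>The exponents: \<open>\<epsilon>\<close> has order \<open>n\<close> to the power \<open>\<beta> - 1 / d\<close>, so the expected number of users
  within \<open>\<epsilon>\<close> of user 1 has order \<open>n\<close> to the power \<open>\<beta> * d\<close>, while \<open>m * \<epsilon>\<^sup>2\<close> vanishes.\<close>

lemma radius_exponents:
  fixes d \<alpha> \<beta> c :: real and m :: "nat \<Rightarrow> nat"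
  assumes d: "d > 0" and c: "c > 0" and \<beta>: "0 < \<beta>" "2 * \<beta> < \<alpha>" "\<beta> < 1 / d"
    and m: "\<And>n. n \<ge> 1 \<Longrightarrow> m n = nat \<lfloor>c * real n powr (2 / d - \<alpha>)\<rfloor>"
  defines "\<epsilon> \<equiv> \<lambda>n. real n powr (\<beta> - 1 / d)"
  shows "\<epsilon> \<longlonglongrightarrow> 0" and "(\<lambda>n. real (m n + 1) * (\<epsilon> n)\<^sup>2) \<longlonglongrightarrow> 0"
proof -
  show "\<epsilon> \<longlonglongrightarrow> 0"
    unfolding \<epsilon>_def using \<beta> by (intro powr_tendsto_0) simp
  \<comment> \<open>The two powers belong to the two summands of m + 1: the trace length calls for 2
    * \<beta> < \<alpha>, the extra time point for \<beta> < 1 / d.\<close>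
  have lim: "(\<lambda>n. c * real n powr (2 * \<beta> - \<alpha>) + real n powr (2 * \<beta> - 2 / d)) \<longlonglongrightarrow> c * 0 + 0"
    using \<beta> d by (intro tendsto_intros powr_tendsto_0) (auto simp: field_simps)
  have "real (m n + 1) * (\<epsilon> n)\<^sup>2 \<le> c * real n powr (2 * \<beta> - \<alpha>) + real n powr (2 * \<beta> - 2 / d)" if n: "n \<ge> 1" for n
  proof -
    have sq: "(\<epsilon> n)\<^sup>2 = real n powr (2 * \<beta> - 2 / d)"
      using n by (simp add: \<epsilon>_def powr_power algebra_simps)
    have "real (m n) \<le> c * real n powr (2 / d - \<alpha>)"
      using c by (simp add: m[OF n])
    then have "real (m n + 1) * (\<epsilon> n)\<^sup>2 \<le> (c * real n powr (2 / d - \<alpha>) + 1) * (\<epsilon> n)\<^sup>2"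
      by (intro mult_right_mono) auto
    also have "\<dots> = c * (real n powr (2 / d - \<alpha>) * real n powr (2 * \<beta> - 2 / d)) + real n powr (2 * \<beta> - 2 / d)"
      by (simp add: sq algebra_simps)
    also have "real n powr (2 / d - \<alpha>) * real n powr (2 * \<beta> - 2 / d) = real n powr (2 * \<beta> - \<alpha>)"
      by (simp flip: powr_add)
    finally show ?thesis .
  qed
  then have le: "eventually (\<lambda>n. real (m n + 1) * (\<epsilon> n)\<^sup>2 \<le> c * real n powr (2 * \<beta> - \<alpha>) + real n powr (2 * \<beta> - 2 / d)) sequentially"
    by (rule eventually_sequentiallyI)
  show "(\<lambda>n. real (m n + 1) * (\<epsilon> n)\<^sup>2) \<longlonglongrightarrow> 0"
    by (rule tendsto_sandwich[OF _ le tendsto_const]) (use lim in simp_all)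
qed

section \<open>Choice of the radius and passage to the limit\<close>

theorem theorem2:
  fixes M :: "'a measure"
    and r :: nat and c \<alpha> b \<delta>1 \<delta>2 :: real
    and m :: "nat \<Rightarrow> nat"
    and q :: "nat \<Rightarrow> real"
    and p :: "nat \<Rightarrow> 'a \<Rightarrow> nat \<Rightarrow> real"
    and f :: "(nat \<Rightarrow> real) \<Rightarrow> real"
    and X :: "nat \<Rightarrow> nat \<Rightarrow> 'a \<Rightarrow> nat"
    and Perm :: "nat \<Rightarrow> 'a \<Rightarrow> nat \<Rightarrow> nat"
  assumes M: "prob_space M"
    and r: "r \<ge> 2" and c: "c > 0" and \<alpha>: "\<alpha> > 0"
    and b: "b > 1"
    and m: "\<And>n. n \<ge> 1 \<Longrightarrow> m n = nat \<lfloor>c * real n powr (2 / (real r - 1) - \<alpha>)\<rfloor>"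
    \<comment> \<open>the parameter vectors\<close>
    and p_rv: "\<And>u. u \<ge> 1 \<Longrightarrow> p u \<in> measurable M (vec_space r)"
    and p_prob: "\<And>u \<omega>. u \<ge> 1 \<Longrightarrow> \<omega> \<in> space M \<Longrightarrow> prob_vector r (p u \<omega>)"
    and q: "prob_vector r q" "\<And>i. i < r \<Longrightarrow> q i \<in> {0<..<1}"
    and p1: "\<And>\<omega> i. \<omega> \<in> space M \<Longrightarrow> i < r \<Longrightarrow> p 1 \<omega> i = q i"
    and p_indep: "prob_space.indep_vars M (\<lambda>_. vec_space r) p {2..}"
    and p_density: "\<And>u. u \<ge> 2 \<Longrightarrow>
          distributed M (PiM {..<r - 1} (\<lambda>_. lborel)) (\<lambda>\<omega>. restrict (p u \<omega>) {..<r - 1})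
            (\<lambda>x. ennreal (f x))"
    and f_cont: "continuous_on (param_region r) f"
    and \<delta>: "\<delta>1 > 0" "\<delta>2 > 0"
    and f_bounds: "\<And>x. x \<in> param_region r \<Longrightarrow> \<delta>1 < f x \<and> f x < \<delta>2"
    and f_zero: "\<And>x. x \<in> extensional {..<r - 1} - param_region r \<Longrightarrow> f x = 0"
    \<comment> \<open>the user locations\<close>
    and X_rv: "\<And>u t. u \<ge> 1 \<Longrightarrow> t \<ge> 1 \<Longrightarrow> X u t \<in> measurable M (count_space {..<r})"
    and X_law: "\<And>u t i. u \<ge> 1 \<Longrightarrow> t \<ge> 1 \<Longrightarrow> i < r \<Longrightarrow>
          AE \<omega> in M. cond_prob_sigma M (params_sigma M r p) {\<omega> \<in> space M. X u t \<omega> = i} \<omega> = p u \<omega> i"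
    and X_indep: "cond_indep_discrete M (params_sigma M r p) (\<lambda>(u, t). X u t) ({1..} \<times> {1..})"
    \<comment> \<open>the anonymizing permutations\<close>
    and Perm_rv: "\<And>n. n \<ge> 1 \<Longrightarrow> Perm n \<in> measurable M (count_space (permutations_upto n))"
    and Perm_unif: "\<And>n. n \<ge> 1 \<Longrightarrow>
          distr M (count_space (permutations_upto n)) (Perm n) =
            uniform_count_measure (permutations_upto n)"
    and Perm_indep: "\<And>n. n \<ge> 1 \<Longrightarrow>
          prob_space.indep_set M
            (sets (vimage_algebra (space M) (Perm n) (count_space (permutations_upto n))))
            (sets (params_locations_sigma M r p X))"
  shows "\<forall>k\<ge>1.
    (\<lambda>n. prob_space.conditional_mutual_information M b
           (count_space {..<r}) (matrix_space r (m n) n) (PiM {1..n} (\<lambda>_. vec_space r))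
           (X 1 k) (\<lambda>\<omega>. obs_matrix X (Perm n \<omega>) (m n) n \<omega>) (\<lambda>\<omega>. \<lambda>u\<in>{1..n}. p u \<omega>))
    \<longlonglongrightarrow> 0"
proof (intro allI impI)
  fix k :: nat assume k: "k \<ge> 1"
  interpret prob_space M by (rule M)
  interpret anonymized_locations M r p X Perm
  proof (intro anonymized_locations.intro anonymized_locations_axioms.intro M)
  qed (erule p_rv, erule p_prob, assumption, erule X_rv, assumption, erule X_law, assumption, assumption,
      rule X_indep, erule Perm_rv, erule Perm_unif, erule Perm_indep)
  define d where "d = r - 1"
  have d: "real d = real r - 1" "d \<ge> 1" using r by (auto simp: d_def)
  \<comment> \<open>Half of the admissible supremum, so that both strict inequalities hold.\<close>
  define \<beta> where "\<beta> = min (\<alpha> / 4) (1 / (2 * real d))"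
  have \<beta>: "0 < \<beta>" "2 * \<beta> < \<alpha>" "\<beta> < 1 / real d"
    using \<alpha> d(2) by (auto simp: \<beta>_def min_def field_simps)
  define \<epsilon> where "\<epsilon> n = real n powr (\<beta> - 1 / real d)" for n
  have m': "m n = nat \<lfloor>c * real n powr (2 / real d - \<alpha>)\<rfloor>" if "n \<ge> 1" for n
    using m[OF that] by (simp add: d(1))
  have "0 < real d" using d(2) by simp
  note limits = radius_exponents[OF this c \<beta>, of m]
  have exponents: "\<epsilon> \<longlonglongrightarrow> 0" "(\<lambda>n. real (m n + 1) * (\<epsilon> n)\<^sup>2) \<longlonglongrightarrow> 0"
    unfolding \<epsilon>_def[abs_def] by (rule limits, erule m')+
  \<comment> \<open>A minimum over finitely many positive coordinates, hence positive and
    independent of n.\<close>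
  define \<kappa> where "\<kappa> = Min (q ` {..<r})"
  have \<kappa>: "0 < \<kappa>" "\<And>j. j < r \<Longrightarrow> \<kappa> \<le> q j"
  proof -
    have "\<kappa> \<in> q ` {..<r}" unfolding \<kappa>_def using r by (intro Min_in) (auto simp: lessThan_empty_iff)
    then show "0 < \<kappa>" using q(2) by auto
    show "\<kappa> \<le> q j" if "j < r" for j using that by (auto simp: \<kappa>_def)
  qed
  define N where "N n = expectation (\<lambda>\<omega>. 1 / sqrt (real (card (user_set n q (\<epsilon> n) \<omega>))))" for n
  define C where "C = real r / (\<kappa> * ln b)"
  define I where "I n = conditional_mutual_information b
           (count_space {..<r}) (matrix_space r (m n) n) (PiM {1..n} (\<lambda>_. vec_space r))
           (X 1 k) (\<lambda>\<omega>. obs_matrix X (Perm n \<omega>) (m n) n \<omega>) (params_upto n)" for n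
  define err where "err n = \<epsilon> n + sqrt (8 * (real (m n + 1) * real r * (\<epsilon> n)\<^sup>2 / \<kappa>))" for n
  define \<rho> where "\<rho> n = \<delta>1 * (2 * \<epsilon> n / real r) ^ d" for n
  have I: "0 \<le> I n" "I n \<le> C * (N n + err n)" if n: "n \<ge> 1" for n
    using conditional_mutual_information_bounds[OF b n k p1 \<kappa>, of "\<epsilon> n" "m n"]
    by (simp_all add: I_def C_def N_def err_def \<epsilon>_def add.assoc)
  \<comment> \<open>Once \<epsilon> n \<le> \<kappa>, the cube about \<open>q\<close> fits into the
    region. Only users 2 to n are random, whence \<open>n - 1\<close>.\<close>
  have N_le: "N n \<le> 1 / sqrt (1 + real K) + 2 ^ K * exp (- \<rho> n * real (n - 1) / 2)"
    if n: "n \<ge> 1" and small: "\<epsilon> n \<le> \<kappa>" for n K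
  proof -
    define A where "A = {v \<in> space (vec_space r). \<forall>j\<in>{..<r}. \<bar>v j - q j\<bar> \<le> \<epsilon> n}"
    have [measurable]: "(\<lambda>v. v j) \<in> borel_measurable (vec_space r)" if "j \<in> {..<r}" for j
      unfolding vec_space_def using that by (rule measurable_component_singleton)
    have A: "A \<in> sets (vec_space r)" unfolding A_def by measurable
    have \<epsilon>0: "0 < \<epsilon> n" using n by (simp add: \<epsilon>_def)
    have near: "\<rho> n \<le> prob {\<omega> \<in> space M. p u \<omega> \<in> A}" if u: "u \<in> {2..n}" for u
    proof -
      have u2: "u \<ge> 2" "u \<ge> 1" using u by auto
      have "\<rho> n \<le> prob {\<omega> \<in> space M. \<forall>j<r. \<bar>p u \<omega> j - q j\<bar> \<le> \<epsilon> n}"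
        unfolding \<rho>_def d_def
      proof (rule prob_near_ge_of_density[OF r q(1) \<epsilon>0 _ p_rv[OF u2(2)] p_prob[OF u2(2)] p_density[OF u2(1)]])
        show "\<epsilon> n \<le> q j" if "j < r" for j using small \<kappa>(2)[OF that] by simp
        show "\<delta>1 < f x" if "x \<in> param_region r" for x using f_bounds[OF that] by simp
      qed (simp_all add: \<delta>)
      also have "{\<omega> \<in> space M. \<forall>j<r. \<bar>p u \<omega> j - q j\<bar> \<le> \<epsilon> n} = {\<omega> \<in> space M. p u \<omega> \<in> A}"
        using measurable_space[OF p_rv[OF u2(2)]] by (auto simp: A_def)
      finally show ?thesis .
    qed
    have "N n = expectation (\<lambda>\<omega>. 1 / sqrt (1 + real (card {u \<in> {2..n}. p u \<omega> \<in> A})))"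
      unfolding N_def A_def using n \<epsilon>0 p1
      by (intro Bochner_Integration.integral_cong refl) (simp add: card_user_set_eq)
    also have "\<dots> \<le> 1 / sqrt (1 + real K) + 2 ^ K * exp (- \<rho> n * real (card {2..n}) / 2)"
      using near by (intro expectation_inverse_sqrt_count_le[OF _ _ A] indep_vars_subset[OF p_indep]) auto
    finally show ?thesis by simp
  qed
  have \<rho>_lim: "filterlim (\<lambda>n. \<rho> n * real (n - 1)) at_top sequentially"
  proof (rule filterlim_at_top_mono)
    \<comment> \<open>The final division by 2 pays for replacing n by n - 1 when n \<ge> 2.\<close>
    define \<gamma> where "\<gamma> = \<delta>1 * (2 / real r) ^ d / 2"
    have \<gamma>: "0 < \<gamma>" using \<delta>(1) r by (simp add: \<gamma>_def)
    have "filterlim (\<lambda>n. real n powr (\<beta> * real d)) at_top sequentially"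
    proof -
      have "0 < \<beta> * real d" using \<beta>(1) d(2) by simp
      then show ?thesis by real_asymp
    qed
    then show "filterlim (\<lambda>n. \<gamma> * real n powr (\<beta> * real d)) at_top sequentially"
      by (rule filterlim_tendsto_pos_mult_at_top[OF tendsto_const \<gamma>])
    show "\<forall>\<^sub>F n in sequentially. \<gamma> * real n powr (\<beta> * real d) \<le> \<rho> n * real (n - 1)"
    proof (rule eventually_sequentiallyI[of 2])
      fix n :: nat assume n: "n \<ge> 2"
      have "(\<epsilon> n) ^ d * real n = real n powr (\<beta> * real d)"
      proof -
        have "(\<epsilon> n) ^ d = real n powr (\<beta> * real d - 1)"
        proof -
          have "real d * (\<beta> - 1 / real d) = \<beta> * real d - 1"
            using d(2) by (simp add: field_simps)
          then show ?thesis using n by (simp add: \<epsilon>_def powr_power)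
        qed
        then show ?thesis using n by (simp add: powr_diff)
      qed
      then have "\<gamma> * real n powr (\<beta> * real d) = \<rho> n * (real n / 2)"
        by (simp add: \<gamma>_def \<rho>_def power_divide power_mult_distrib mult_ac)
      also have "\<dots> \<le> \<rho> n * real (n - 1)"
        using n \<delta>(1) by (intro mult_left_mono) (auto simp: \<rho>_def \<epsilon>_def)
      finally show "\<gamma> * real n powr (\<beta> * real d) \<le> \<rho> n * real (n - 1)" .
    qed
  qed
  have exp_lim: "(\<lambda>n. exp (- \<rho> n * real (n - 1) / 2)) \<longlonglongrightarrow> 0"
  proof -
    have "filterlim (\<lambda>n. 1 / 2 * (\<rho> n * real (n - 1))) at_top sequentially"
      by (rule filterlim_tendsto_pos_mult_at_top[OF tendsto_const _ \<rho>_lim]) simp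
    then have "filterlim (\<lambda>n. - (1 / 2 * (\<rho> n * real (n - 1)))) at_bot sequentially"
      by (simp add: filterlim_uminus_at_bot)
    from filterlim_compose[OF exp_at_bot this] show ?thesis by simp
  qed
  have err_lim: "err \<longlonglongrightarrow> 0"
  proof -
    have "(\<lambda>n. \<epsilon> n + sqrt (8 * real r / \<kappa> * (real (m n + 1) * (\<epsilon> n)\<^sup>2))) \<longlonglongrightarrow> 0 + sqrt (8 * real r / \<kappa> * 0)"
      by (intro tendsto_intros exponents)
    then show ?thesis by (simp add: err_def[abs_def] mult_ac)
  qed
  have "I \<longlonglongrightarrow> 0"
  proof (rule tendsto_0_if_eventually_le)
    show "eventually (\<lambda>n. 0 \<le> I n) sequentially"
      using I(1) by (rule eventually_sequentiallyI)
    show "eventually (\<lambda>n. I n \<le> C * (1 / sqrt (1 + real K) + 2 ^ K * exp (- \<rho> n * real (n - 1) / 2) + err n)) sequentially" for K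
      using order_tendstoD(2)[OF exponents(1) \<kappa>(1)] eventually_ge_at_top[of 1]
    proof eventually_elim
      case (elim n)
      have "I n \<le> C * (N n + err n)" using I(2) elim by simp
      also have "\<dots> \<le> C * (1 / sqrt (1 + real K) + 2 ^ K * exp (- \<rho> n * real (n - 1) / 2) + err n)"
        using N_le[of n K] elim \<kappa>(1) b by (intro mult_left_mono add_right_mono) (auto simp: C_def)
      finally show ?case .
    qed
    show "(\<lambda>n. C * (1 / sqrt (1 + real K) + 2 ^ K * exp (- \<rho> n * real (n - 1) / 2) + err n))
        \<longlonglongrightarrow> C * (1 / sqrt (1 + real K) + 2 ^ K * 0 + 0)" for K
      by (intro tendsto_intros exp_lim err_lim)
    \<comment> \<open>Only now does \<open>K\<close> grow: for fixed \<open>K\<close> the constant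
      2^K has already been beaten by the exponential decay in n.\<close>
    have "(\<lambda>K. (1 + real K) powr (- (1 / 2))) \<longlonglongrightarrow> 0"
      by (intro tendsto_neg_powr filterlim_tendsto_add_at_top[OF tendsto_const] filterlim_real_sequentially) simp
    then have "(\<lambda>K. 1 / sqrt (1 + real K)) \<longlonglongrightarrow> 0"
      by (simp add: powr_minus powr_half_sqrt inverse_eq_divide)
    then have "(\<lambda>K. C * (1 / sqrt (1 + real K) + 2 ^ K * 0 + 0)) \<longlonglongrightarrow> C * (0 + 0 + 0)"
      by (intro tendsto_intros) auto
    then show "(\<lambda>K. C * (1 / sqrt (1 + real K) + 2 ^ K * 0 + 0)) \<longlonglongrightarrow> 0" by simp
  qed
  then show "(\<lambda>n. conditional_mutual_information b
           (count_space {..<r}) (matrix_space r (m n) n) (PiM {1..n} (\<lambda>_. vec_space r))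
           (X 1 k) (\<lambda>\<omega>. obs_matrix X (Perm n \<omega>) (m n) n \<omega>) (\<lambda>\<omega>. \<lambda>u\<in>{1..n}. p u \<omega>)) \<longlonglongrightarrow> 0"
    by (simp add: I_def[abs_def] params_upto_def[abs_def])
qed

end
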